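(* Let $\lambda\in\mathbb{C}$. Then: (i) $\tilde d_\lambda=d_\lambda$ if and only if system (S$_\lambda$) is definite on $\mathbb{N}_0$; (ii) $d_\lambda-\tilde d_\lambda$ is nonnegative and constant for $\lambda\in\mathbb{C}$; (iii) $d_\lambda$ is constant in $\mathbb{C}_+=\{\lambda\in\mathbb{C}:\Im(\lambda)>0\}$ and in $\mathbb{C}_-=\{\lambda\in\mathbb{C}:\Im(\lambda)<0\}$.
   Context: Let $n\in\mathbb{N}$, $\mathbb{N}_0=\{0,1,2,\dots\}$ and $\mathcal{J}=\begin{pmatrix}0&I_n\\-I_n&0\end{pmatrix}$. For each $k\in\mathbb{N}_0$ let $S_k,\Psi_k\in\mathbb{C}^{2n\times2n}$ satisfy $S_k^*\mathcal{J}S_k=\mathcal{J}$, $\Psi_k^*=\Psi_k\ge0$ (positive semi-definite) and $\Psi_k\mathcal{J}\Psi_k=0$. Put $V_k=-\mathcal{J}\Psi_kS_k$ and $\mathbb{S}_k(\lambda)=S_k+\lambda V_k$, $\lambda\in\mathbb{C}$; these matrices are invertible. System (S$_\lambda$) is $z_k=\mathbb{S}_k(\lambda)z_{k+1}$, $k\in\mathbb{N}_0$. With $\mathscr{L}(z)_k=\mathcal{J}(z_k-S_kz_{k+1})$, system (S$_\lambda$) is equivalent to $\mathscr{L}(z)_k=\lambda\Psi_kz_k$, $k\in\mathbb{N}_0$. System (S$_\lambda$) is definite on $\mathbb{N}_0$ if for each $\lambda\in\mathbb{C}$ and every nontrivial solution $z(\lambda)$ of (S$_\lambda$) one has $\sum_{k\in\mathbb{N}_0}z_k^*(\lambda)\Psi_kz_k(\lambda)>0$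 (so this is a property of the family, not of a single $\lambda$). $\|z\|_\Psi=\big(\sum_{k=0}^\infty z_k^*\Psi_kz_k\big)^{1/2}$, $\ell^2_\Psi(\mathbb{N}_0)$ is the space of sequences in $\mathbb{C}^{2n}$ with $\|z\|_\Psi<\infty$, and $\tilde\ell^2_\Psi(\mathbb{N}_0)$ is the Hilbert space obtained as its quotient by $\{z:\|z\|_\Psi=0\}$; classes are denoted $\tilde z$. The maximal linear relation is $T_{\max}=\{\{\tilde z,\tilde f\}\in\tilde\ell^2_\Psi(\mathbb{N}_0)\times\tilde\ell^2_\Psi(\mathbb{N}_0):\exists\,u\in\tilde z\text{ with }\mathscr{L}(u)=\Psi f\}$, where $\mathscr{L}(u)=\Psi f$ means $\mathscr{L}(u)_k=\Psi_kf_k$ for all $k\in\mathbb{N}_0$. Define $M_\lambda=\{z\in\ell^2_\Psi(\mathbb{N}_0):\mathscr{L}(z)_k=\lambda\Psi_kz_k,\ k\in\mathbb{N}_0\}$, $d_\lambda=\dim M_\lambda$ (the number of linearly independent square summable solutions of (S$_\lambda$)), $\widetilde M_\lambda=\{\tilde z\in\tilde\ell^2_\Psi(\mathbb{N}_0):\{\tilde z,\lambda\tilde z\}\in T_{\max}\}$ and $\tilde d_\lambda=\dim\widetilde M_\lambda$ (the deficiency index of the minimal relation). *)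

theory Defs
  imports "HOL-Analysis.Analysis" "Jordan_Normal_Form.Missing_VectorSpace"
begin

text \<open>
  Vectors of \<open>\<complex>\<^sup>2\<^sup>n\<close> have type \<open>complex ^ ('n + 'n)\<close> with \<open>n = CARD('n)\<close>; the summands
  \<open>Inl\<close> and \<open>Inr\<close> of the index type address the upper and the lower half of a vector.
\<close>

type_synonym 'n cvec = "complex ^ ('n + 'n)"
type_synonym 'n cmat = "complex ^ ('n + 'n) ^ ('n + 'n)"

definition J_mat :: "('n::finite) cmat" where
  "J_mat = (\<chi> i j. case (i, j) of
      (Inl a, Inr b) \<Rightarrow> if a = b then 1 else 0
    | (Inr a, Inl b) \<Rightarrow> if a = b then - 1 else 0
    | _ \<Rightarrow> 0)"

definition conj_transpose :: "complex ^ 'm ^ 'm \<Rightarrow> complex ^ 'm ^ 'm" where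
  "conj_transpose A = (\<chi> i j. cnj (A $ j $ i))"

text \<open>\<open>z\<^sup>* A z\<close>; it is real for Hermitian \<open>A\<close>.\<close>

definition herm_form :: "complex ^ 'm ^ 'm \<Rightarrow> complex ^ 'm \<Rightarrow> complex" where
  "herm_form A z = (\<Sum>i\<in>UNIV. cnj (z $ i) * (A *v z) $ i)"

definition pos_semidef :: "complex ^ 'm ^ 'm \<Rightarrow> bool" where
  "pos_semidef A \<longleftrightarrow> conj_transpose A = A \<and> (\<forall>z. 0 \<le> Re (herm_form A z))"

definition V_mat :: "(nat \<Rightarrow> ('n::finite) cmat) \<Rightarrow> (nat \<Rightarrow> 'n cmat) \<Rightarrow> nat \<Rightarrow> 'n cmat" where
  "V_mat S \<Psi> k = - (J_mat ** \<Psi> k ** S k)"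

definition S_lam ::
  "(nat \<Rightarrow> ('n::finite) cmat) \<Rightarrow> (nat \<Rightarrow> 'n cmat) \<Rightarrow> complex \<Rightarrow> nat \<Rightarrow> 'n cmat" where
  "S_lam S \<Psi> l k = (\<chi> i j. S k $ i $ j + l * V_mat S \<Psi> k $ i $ j)"

definition is_solution ::
  "(nat \<Rightarrow> ('n::finite) cmat) \<Rightarrow> (nat \<Rightarrow> 'n cmat) \<Rightarrow> complex \<Rightarrow> (nat \<Rightarrow> 'n cvec) \<Rightarrow> bool" where
  "is_solution S \<Psi> l z \<longleftrightarrow> (\<forall>k. z k = S_lam S \<Psi> l k *v z (Suc k))"

definition L_op :: "(nat \<Rightarrow> ('n::finite) cmat) \<Rightarrow> (nat \<Rightarrow> 'n cvec) \<Rightarrow> nat \<Rightarrow> 'n cvec" where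
  "L_op S z k = J_mat *v (z k - S k *v z (Suc k))"

text \<open>
  The square of \<open>\<parallel>z\<parallel>\<^sub>\<Psi>\<close>. It takes the value \<open>\<infinity>\<close> when the series diverges. The truncation of
  negative numbers by \<open>ennreal\<close> is irrelevant for positive semidefinite weights.
\<close>

definition psi_norm_sq :: "(nat \<Rightarrow> complex ^ 'm ^ 'm) \<Rightarrow> (nat \<Rightarrow> complex ^ 'm) \<Rightarrow> ennreal" where
  "psi_norm_sq \<Psi> z = (\<Sum>k. ennreal (Re (herm_form (\<Psi> k) (z k))))"

definition definite_system ::
  "(nat \<Rightarrow> ('n::finite) cmat) \<Rightarrow> (nat \<Rightarrow> 'n cmat) \<Rightarrow> bool" where
  "definite_system S \<Psi> \<longleftrightarrow>
     (\<forall>l z. is_solution S \<Psi> l z \<and> z \<noteq> (\<lambda>k. 0) \<longrightarrow> psi_norm_sq \<Psi> z > 0)"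

definition l2_psi :: "(nat \<Rightarrow> complex ^ 'm ^ 'm) \<Rightarrow> (nat \<Rightarrow> complex ^ 'm) set" where
  "l2_psi \<Psi> = {z. psi_norm_sq \<Psi> z < \<infinity>}"

definition psi_rel ::
  "(nat \<Rightarrow> complex ^ 'm ^ 'm) \<Rightarrow> ((nat \<Rightarrow> complex ^ 'm) \<times> (nat \<Rightarrow> complex ^ 'm)) set" where
  "psi_rel \<Psi> = {(z, w). z \<in> l2_psi \<Psi> \<and> w \<in> l2_psi \<Psi> \<and> psi_norm_sq \<Psi> (\<lambda>k. z k - w k) = 0}"

definition psi_class ::
  "(nat \<Rightarrow> complex ^ 'm ^ 'm) \<Rightarrow> (nat \<Rightarrow> complex ^ 'm) \<Rightarrow> (nat \<Rightarrow> complex ^ 'm) set" where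
  "psi_class \<Psi> z = psi_rel \<Psi> `` {z}"

text \<open>
  The quotient space depends on the value \<open>\<Psi>\<close> and hence is not a type. Dimensions are therefore
  taken with \<open>vectorspace.dim\<close>, whose vector spaces are records with an explicit carrier. The
  record fields \<open>mult\<close> and \<open>one\<close> play no role for vector spaces. All spaces whose dimension is
  taken below are finite-dimensional for weights and coefficients as in the theorem.
\<close>

definition complex_field :: "complex ring" where
  "complex_field = \<lparr>carrier = UNIV, mult = (*), one = 1, zero = 0, add = (+)\<rparr>"

definition seq_space :: "(complex, nat \<Rightarrow> complex ^ 'm) module" where
  "seq_space = \<lparr>carrier = UNIV, mult = undefined, one = undefined,
     zero = (\<lambda>k. 0), add = (\<lambda>x y k. x k + y k), smult = (\<lambda>c x k. c *s x k)\<rparr>"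

definition l2_quot ::
  "(nat \<Rightarrow> complex ^ 'm ^ 'm) \<Rightarrow> (complex, (nat \<Rightarrow> complex ^ 'm) set) module" where
  "l2_quot \<Psi> = \<lparr>carrier = l2_psi \<Psi> // psi_rel \<Psi>, mult = undefined, one = undefined,
     zero = psi_class \<Psi> (\<lambda>k. 0),
     add = (\<lambda>X Y. \<Union>x\<in>X. \<Union>y\<in>Y. psi_class \<Psi> (\<lambda>k. x k + y k)),
     smult = (\<lambda>c X. \<Union>x\<in>X. psi_class \<Psi> (\<lambda>k. c *s x k))\<rparr>"

text \<open>
  In \<open>T_max\<close> the representative \<open>f\<close> is arbitrary, since \<open>\<Psi>\<^sub>k f\<^sub>k\<close> depends only on the class of \<open>f\<close>;
  the representative \<open>u\<close> is not.
\<close>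

definition T_max ::
  "(nat \<Rightarrow> ('n::finite) cmat) \<Rightarrow> (nat \<Rightarrow> 'n cmat)
     \<Rightarrow> ((nat \<Rightarrow> 'n cvec) set \<times> (nat \<Rightarrow> 'n cvec) set) set" where
  "T_max S \<Psi> = {(psi_class \<Psi> z, psi_class \<Psi> f) | z f.
     z \<in> l2_psi \<Psi> \<and> f \<in> l2_psi \<Psi> \<and> (\<exists>u \<in> psi_class \<Psi> z. \<forall>k. L_op S u k = \<Psi> k *v f k)}"

definition M_space ::
  "(nat \<Rightarrow> ('n::finite) cmat) \<Rightarrow> (nat \<Rightarrow> 'n cmat) \<Rightarrow> complex \<Rightarrow> (nat \<Rightarrow> 'n cvec) set" where
  "M_space S \<Psi> l = {z \<in> l2_psi \<Psi>. \<forall>k. L_op S z k = l *s (\<Psi> k *v z k)}"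

definition M_quot ::
  "(nat \<Rightarrow> ('n::finite) cmat) \<Rightarrow> (nat \<Rightarrow> 'n cmat) \<Rightarrow> complex \<Rightarrow> (nat \<Rightarrow> 'n cvec) set set" where
  "M_quot S \<Psi> l = {Z \<in> carrier (l2_quot \<Psi>). (Z, l \<odot>\<^bsub>l2_quot \<Psi>\<^esub> Z) \<in> T_max S \<Psi>}"

definition d_sol ::
  "(nat \<Rightarrow> ('n::finite) cmat) \<Rightarrow> (nat \<Rightarrow> 'n cmat) \<Rightarrow> complex \<Rightarrow> nat" where
  "d_sol S \<Psi> l = vectorspace.dim complex_field (seq_space\<lparr>carrier := M_space S \<Psi> l\<rparr>)"

definition d_quot ::
  "(nat \<Rightarrow> ('n::finite) cmat) \<Rightarrow> (nat \<Rightarrow> 'n cmat) \<Rightarrow> complex \<Rightarrow> nat" where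
  "d_quot S \<Psi> l = vectorspace.dim complex_field ((l2_quot \<Psi>)\<lparr>carrier := M_quot S \<Psi> l\<rparr>)"

end

theory Submission
  imports Defs
begin

text \<open>
  A solution is determined by its initial value \<open>z\<^sub>0\<close>. If its norm vanishes, then \<open>\<Psi>\<^sub>k z\<^sub>k = 0\<close> for
  all \<open>k\<close>, so the parameter drops out of the equation. Hence the kernel \<open>K\<close> of the quotient map
  from \<open>M\<^sub>\<lambda>\<close> onto its image in the quotient space does not depend on \<open>\<lambda>\<close>, and it is trivial exactly
  for definite systems.

  The dimension of \<open>M\<^sub>\<lambda>\<close> is locally constant off the real line because for
  \<open>\<bar>\<mu> - \<lambda>\<bar> < \<bar>Im \<lambda>\<bar>\<close> every \<open>z \<in> M\<^sub>\<mu>\<close> orthogonal to \<open>M\<^sub>\<lambda>\<close> lies in \<open>K\<close>. To see this, let \<open>p\<^sup>N\<close> be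
  the orthogonal projection of \<open>z\<close>, on the window \<open>[0, N)\<close>, to the solutions for \<open>\<lambda>\<close>, and \<open>f = z - p\<^sup>N\<close>.
  The solution of \<open>L y = \<Psi> (cnj \<lambda> y + f)\<close> with \<open>y\<^sub>0 = 0\<close> satisfies \<open>y\<^sub>N = 0\<close>, and Green's identity
  for the pairs \<open>(y, y)\<close> and \<open>(y, z)\<close> gives \<open>\<parallel>f\<parallel> \<le> r \<parallel>z\<parallel>\<close> with \<open>r = \<bar>\<mu> - \<lambda>\<bar> / \<bar>Im \<lambda>\<bar> < 1\<close>. A limit
  point \<open>p\<close> of the \<open>p\<^sup>N\<close>, taken modulo \<open>K\<close>, lies in \<open>M\<^sub>\<lambda>\<close> and satisfies
  \<open>Re \<langle>p, z\<rangle> \<ge> (1 - r\<^sup>2) \<parallel>z\<parallel>\<^sup>2\<close>.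
\<close>

section \<open>Dimensions of linear images\<close>

lemma field_complex_field: "field complex_field"
proof -
  have "cring complex_field"
  proof (rule cringI)
    show "abelian_group complex_field"
    proof (rule abelian_groupI)
      show "\<exists>y\<in>carrier complex_field. y \<oplus>\<^bsub>complex_field\<^esub> x = \<zero>\<^bsub>complex_field\<^esub>" for x
        by (rule bexI[of _ "- x"]) (auto simp: complex_field_def)
    qed (auto simp: complex_field_def)
    show "Group.comm_monoid complex_field"
      by (rule comm_monoidI) (auto simp: complex_field_def)
  qed (auto simp: complex_field_def algebra_simps)
  then show ?thesis
  proof (rule cring.cring_fieldI)
    have "a \<in> Units complex_field" if "a \<noteq> 0" for a
      using that unfolding Units_def
      by (auto simp: complex_field_def intro!: exI[of _ "inverse a"])
    then show "Units complex_field = carrier complex_field - {\<zero>\<^bsub>complex_field\<^esub>}"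
      by (auto simp: Units_def) (auto simp: complex_field_def)
  qed
qed

text \<open>The carriers in \<open>d_sol\<close> and \<open>d_quot\<close> are both images of a
  space of initial values, so one rank-nullity argument serves both. Linearity is asked for on
  \<open>E\<close> only, since \<open>l2_quot\<close> contains classes of sequences of finite norm
  only.\<close>

locale linear_image =
  fixes E :: "(complex ^ 'm) set" and W :: "(complex, 'w) module" and T :: "complex ^ 'm \<Rightarrow> 'w"
  assumes subspace_E: "vec.subspace E"
    and carrier_eq: "carrier W = T ` E"
    and T_add: "\<And>x y. x \<in> E \<Longrightarrow> y \<in> E \<Longrightarrow> T x \<oplus>\<^bsub>W\<^esub> T y = T (x + y)"
    and T_scale: "\<And>c x. x \<in> E \<Longrightarrow> c \<odot>\<^bsub>W\<^esub> T x = T (c *s x)"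
    and T_zero: "\<zero>\<^bsub>W\<^esub> = T 0"
begin

lemmas E_add = vec.subspace_add[OF subspace_E]
  and E_scale = vec.subspace_scale[OF subspace_E]
  and E_zero = vec.subspace_0[OF subspace_E]
  and E_sum = vec.subspace_sum[OF subspace_E]

lemma vectorspace_image: "vectorspace complex_field W"
proof -
  interpret field complex_field by (rule field_complex_field)
  have 1: "abelian_group W"
  proof (rule abelian_groupI)
    fix x assume "x \<in> carrier W"
    then obtain u where u: "u \<in> E" "x = T u" by (auto simp: carrier_eq)
    have "(-1) *s u \<in> E" using u E_scale by blast
    then show "\<exists>y\<in>carrier W. y \<oplus>\<^bsub>W\<^esub> x = \<zero>\<^bsub>W\<^esub>"
      using u by (intro bexI[of _ "T ((-1) *s u)"]) (auto simp: carrier_eq T_add T_zero)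
  qed (auto simp: carrier_eq T_add T_zero E_add E_zero ac_simps)
  have "module complex_field W"
  proof (rule module.intro[OF is_cring 1], unfold_locales)
  qed (auto simp: carrier_eq T_add T_scale E_add E_scale complex_field_def 
        vec.scale_left_distrib vec.scale_right_distrib)
  then show ?thesis
    by (simp add: vectorspace_def field_complex_field)
qed

sublocale vectorspace complex_field W
  by (rule vectorspace_image)

text \<open>Coefficients in \<open>lincomb\<close> are attached to the vectors themselves, so
  elements of \<open>C\<close> with equal images would be counted once; hence the
  injectivity.\<close>

lemma lincomb_image:
  assumes "finite C" "C \<subseteq> E" "inj_on T C"
  shows "lincomb a (T ` C) = T (\<Sum>c\<in>C. a (T c) *s c)"
  using assms
proof (induction C rule: finite_induct)
  case empty
  then show ?case by (simp add: lincomb_def T_zero)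
next
  case (insert c C)
  have "lincomb a (insert (T c) (T ` C)) = a (T c) \<odot>\<^bsub>W\<^esub> T c \<oplus>\<^bsub>W\<^esub> lincomb a (T ` C)"
    using insert by (intro lincomb_insert2) (auto simp: carrier_eq complex_field_def)
  also have "\<dots> = T (a (T c) *s c + (\<Sum>c\<in>C. a (T c) *s c))"
    using insert by (subst insert.IH) (auto simp: T_add T_scale E_scale intro!: T_add E_sum)
  finally show ?case using insert by simp
qed

lemma subspace_kernel: "vec.subspace {x \<in> E. T x = \<zero>\<^bsub>W\<^esub>}"
proof (rule vec.subspaceI)
  show "x + y \<in> {x \<in> E. T x = \<zero>\<^bsub>W\<^esub>}" if "x \<in> {x \<in> E. T x = \<zero>\<^bsub>W\<^esub>}" "y \<in> {x \<in> E. T x = \<zero>\<^bsub>W\<^esub>}" for x y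
    using that T_add[of x y] T_add[of 0 0] by (auto simp: E_add T_zero E_zero)
  show "c *s x \<in> {x \<in> E. T x = \<zero>\<^bsub>W\<^esub>}" if "x \<in> {x \<in> E. T x = \<zero>\<^bsub>W\<^esub>}" for c x
    using that T_scale[of x c] T_scale[of 0 c] by (auto simp: E_scale T_zero E_zero)
qed (simp add: E_zero T_zero)

text \<open>Rank-nullity: a basis \<open>A\<close> of the kernel is extended to a basis
  \<open>B\<close> of \<open>E\<close>, and the images of \<open>C = B - A\<close> form a basis of
  \<open>W\<close>.\<close>

lemma dim_linear_image:
  "dim + vec.dim {x \<in> E. T x = \<zero>\<^bsub>W\<^esub>} = vec.dim E"
proof -
  define K where "K = {x \<in> E. T x = \<zero>\<^bsub>W\<^esub>}"
  obtain A where A: "A \<subseteq> K" "vec.independent A" "K \<subseteq> vec.span A" "card A = vec.dim K"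
    using vec.basis_exists[of K] by blast
  have "A \<subseteq> E" using A by (auto simp: K_def)
  then obtain B where B: "A \<subseteq> B" "B \<subseteq> E" "vec.independent B" "E \<subseteq> vec.span B"
    using vec.maximal_independent_subset_extend[of A E] A by metis
  have finB: "finite B" using B(3) vec.finiteI_independent by blast
  define C where "C = B - A"
  have C: "finite C" "C \<subseteq> E" using finB B by (auto simp: C_def)
  have indep: "(\<forall>c\<in>C. u c = 0)" if u: "T (\<Sum>c\<in>C. u c *s c) = \<zero>\<^bsub>W\<^esub>" for u
  proof -
    have "(\<Sum>c\<in>C. u c *s c) \<in> K"
      using u C by (auto simp: K_def intro!: E_sum E_scale)
    then have "(\<Sum>c\<in>C. u c *s c) \<in> vec.span A" using A by blast
    then obtain w where w: "(\<Sum>c\<in>C. u c *s c) = (\<Sum>a\<in>A. w a *s a)"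
      using vec.span_finite[of A] finB B(1) finite_subset by (metis (no_types, lifting) imageE)
    \<comment> \<open>A combination of \<open>C\<close> in the kernel is also a combination of
      \<open>A\<close>; the difference of the two is a relation on the basis
      \<open>B\<close>.\<close>
    define v where "v b = (if b \<in> A then - w b else u b)" for b
    have "(\<Sum>b\<in>B. v b *s b) = (\<Sum>b\<in>C. v b *s b) + (\<Sum>b\<in>A. v b *s b)"
      unfolding C_def using finB B(1) by (simp add: sum.subset_diff)
    also have "(\<Sum>b\<in>A. v b *s b) = - (\<Sum>a\<in>A. w a *s a)"
      by (simp add: v_def sum_negf)
    also have "(\<Sum>b\<in>C. v b *s b) = (\<Sum>c\<in>C. u c *s c)"
      by (rule sum.cong) (auto simp: v_def C_def)
    finally have "(\<Sum>b\<in>B. v b *s b) = 0" using w by simp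
    then have "\<forall>b\<in>B. v b = 0"
      using vec.independentD[OF B(3) finB subset_refl] by blast
    then show ?thesis by (auto simp: v_def C_def)
  qed
  have inj: "inj_on T C"
  proof (rule inj_onI, rule ccontr)
    fix x y assume xy: "x \<in> C" "y \<in> C" "T x = T y" "x \<noteq> y"
    \<comment> \<open>With these coefficients the combination is \<open>x - y\<close>, which lies in
      the kernel.\<close>
    define u where "u c = (if c = x then 1 else if c = y then -1 else 0 :: complex)" for c
    have "(\<Sum>c\<in>C. u c *s c) = (\<Sum>c\<in>{x,y}. u c *s c)"
      by (rule sum.mono_neutral_right) (use xy C in \<open>auto simp: u_def\<close>)
    also have "\<dots> = x + (-1) *s y" using xy by (simp add: u_def)
    finally have "T (\<Sum>c\<in>C. u c *s c) = T (x + (-1) *s y)" by simp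
    also have "\<dots> = T x \<oplus>\<^bsub>W\<^esub> (-1) \<odot>\<^bsub>W\<^esub> T y"
      using xy C by (metis T_add T_scale E_scale subsetD)
    also have "\<dots> = T y \<oplus>\<^bsub>W\<^esub> (-1) \<odot>\<^bsub>W\<^esub> T y" using xy by simp
    also have "\<dots> = T (y + (-1) *s y)"
      using xy C by (metis T_add T_scale E_scale subsetD)
    also have "\<dots> = \<zero>\<^bsub>W\<^esub>" by (simp add: T_zero)
    finally show False using indep[of u] xy by (auto simp: u_def)
  qed
  have "basis (T ` C)"
    unfolding basis_def
  proof (intro conjI)
    show TC: "T ` C \<subseteq> carrier W" using C by (auto simp: carrier_eq)
    show "lin_indpt (T ` C)"
    proof (rule finite_lin_indpt2)
      fix a assume "lincomb a (T ` C) = \<zero>\<^bsub>W\<^esub>"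
      then show "\<forall>v\<in>T ` C. a v = \<zero>\<^bsub>complex_field\<^esub>"
        using indep[of "\<lambda>c. a (T c)"] lincomb_image[OF C inj] by (auto simp: complex_field_def)
    qed (use C TC in auto)
    have "carrier W \<subseteq> span (T ` C)"
    proof
      fix w assume "w \<in> carrier W"
      then obtain x where x: "x \<in> E" "w = T x" by (auto simp: carrier_eq)
      then have "x \<in> vec.span B" using B by blast
      then obtain v where v: "x = (\<Sum>b\<in>B. v b *s b)"
        using vec.span_finite[OF finB] by auto
      have "x = (\<Sum>b\<in>C. v b *s b) + (\<Sum>b\<in>A. v b *s b)"
        unfolding v C_def using finB B(1) by (simp add: sum.subset_diff)
      moreover have "(\<Sum>b\<in>A. v b *s b) \<in> K"
        unfolding K_def using A(1) subspace_kernel K_def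
        by (intro vec.subspace_sum[OF subspace_kernel] vec.subspace_scale[OF subspace_kernel]) auto
      moreover have CE: "(\<Sum>b\<in>C. v b *s b) \<in> E"
        using C by (auto intro!: E_sum E_scale)
      ultimately have "w = T (\<Sum>b\<in>C. v b *s b) \<oplus>\<^bsub>W\<^esub> \<zero>\<^bsub>W\<^esub>"
        using x by (auto simp: K_def T_add[symmetric])
      also have "\<dots> = T (\<Sum>b\<in>C. v b *s b)"
        using CE by (auto simp: carrier_eq)
      also have "(\<Sum>b\<in>C. v b *s b) = (\<Sum>b\<in>C. v (inv_into C T (T b)) *s b)"
        using inj by (intro sum.cong) auto
      also have "T \<dots> = lincomb (\<lambda>w. v (inv_into C T w)) (T ` C)"
        by (rule lincomb_image[OF C inj, symmetric])
      finally show "w \<in> span (T ` C)"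
        using finite_span[OF _ TC] C by (auto simp: complex_field_def)
    qed
    then show "span (T ` C) = carrier W"
      using span_is_subset2[OF TC] by blast
  qed
  then have "dim = card C"
    using dim_basis[of "T ` C"] C inj by (simp add: card_image)
  moreover have "card B = vec.dim E"
    using B by (intro vec.basis_card_eq_dim) auto
  ultimately show ?thesis
    using A(4) card_mono[OF finB B(1)] finite_subset[OF B(1) finB] B(1)
    unfolding C_def K_def[symmetric] by (simp add: card_Diff_subset)
qed

end

text \<open>Each functional lowers the dimension by at most one. The subspace claim is carried along
  because the next functional is restricted to the kernel obtained so far.\<close>

lemma dim_le_dim_kernel_plus_card:
  fixes V :: "(complex ^ 'm) set" and b :: "'b \<Rightarrow> complex ^ 'm \<Rightarrow> complex"
  assumes "finite C" and V: "vec.subspace V"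
    and add: "\<And>c x y. c \<in> C \<Longrightarrow> x \<in> V \<Longrightarrow> y \<in> V \<Longrightarrow> b c (x + y) = b c x + b c y"
    and scale: "\<And>c r x. c \<in> C \<Longrightarrow> x \<in> V \<Longrightarrow> b c (r *s x) = r * b c x"
  shows "vec.dim V \<le> vec.dim {x \<in> V. \<forall>c\<in>C. b c x = 0} + card C
     \<and> vec.subspace {x \<in> V. \<forall>c\<in>C. b c x = 0}"
  using assms(1) add scale
proof (induction C rule: finite_induct)
  case empty
  then show ?case using V by simp
next
  case (insert c C)
  define U where "U = {x \<in> V. \<forall>c\<in>C. b c x = 0}"
  define U' where "U' = {x \<in> V. \<forall>c\<in>insert c C. b c x = 0}"
  have IH: "vec.dim V \<le> vec.dim U + card C" "vec.subspace U"
    using insert by (auto simp: U_def)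
  have U': "U' = {x \<in> U. b c x = 0}" by (auto simp: U_def U'_def)
  have UV: "U \<subseteq> V" by (auto simp: U_def)
  have b0: "b c 0 = 0"
    using insert.prems(2)[of c 0 0] vec.subspace_0[OF V] by simp
  have sub: "vec.subspace U'"
    unfolding U' using UV insert.prems IH(2) b0
    by (intro vec.subspaceI) (auto simp: subset_eq vec.subspace_add vec.subspace_scale vec.subspace_0)
  have "vec.dim U \<le> vec.dim U' + 1"
  proof (cases "U = U'")
    case False
    then obtain v where v: "v \<in> U" "b c v \<noteq> 0" by (auto simp: U')
    have "U \<subseteq> vec.span (insert v U')"
    proof
      fix x assume x: "x \<in> U"
      \<comment> \<open>\<open>x - r *s v\<close> is annihilated by \<open>b c\<close>, so
        \<open>v\<close> alone spans \<open>U\<close> modulo \<open>U'\<close>.\<close>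
      define r where "r = b c x / b c v"
      have vx: "(- r) *s v \<in> U" using v IH(2) by (metis vec.subspace_scale)
      have "x + (- r) *s v \<in> U" using x vx IH(2) by (metis vec.subspace_add)
      moreover have "b c (x + (- r) *s v) = 0"
      proof -
        have "b c (x + (- r) *s v) = b c x + - r * b c v"
          using insert.prems(1)[of c x "(- r) *s v"] insert.prems(2)[of c v "- r"] x vx v UV
          by (metis insertI1 subsetD)
        then show ?thesis using v by (simp add: r_def)
      qed
      ultimately have "x + (- r) *s v \<in> U'" by (simp add: U')
      then have "x + (- r) *s v + r *s v \<in> vec.span (insert v U')"
        by (blast intro: vec.span_add vec.span_scale vec.span_base)
      then show "x \<in> vec.span (insert v U')" by simp
    qed
    then have "vec.dim U \<le> vec.dim (insert v U')"
      by (metis vec.dim_subset vec.dim_span)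
    then show ?thesis using vec.dim_insert[of v U'] by (auto split: if_splits)
  qed simp
  then show ?case
    using IH(1) sub insert.hyps unfolding U'_def[symmetric] by simp
qed

section \<open>Semidefinite forms\<close>

text \<open>Complex-valued, with \<open>inner\<close> as its real part.\<close>

definition cip :: "complex ^ 'm \<Rightarrow> complex ^ 'm \<Rightarrow> complex" where
  "cip x y = (\<Sum>i\<in>UNIV. cnj (x $ i) * y $ i)"

lemma cip_add: "cip (x + y) z = cip x z + cip y z" "cip x (y + z) = cip x y + cip x z"
  by (simp_all add: cip_def algebra_simps sum.distrib)

lemma cip_scale: "cip (c *s x) y = cnj c * cip x y" "cip x (c *s y) = c * cip x y"
  by (simp_all add: cip_def sum_distrib_left ac_simps)

lemma cip_zero [simp]: "cip 0 x = 0" "cip x 0 = 0"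
  by (simp_all add: cip_def)

lemma cip_minus [simp]: "cip (- x) y = - cip x y" "cip x (- y) = - cip x y"
  by (simp_all add: cip_def sum_negf)

lemma cip_diff: "cip (x - y) z = cip x z - cip y z" "cip x (y - z) = cip x y - cip x z"
  using cip_add(1)[of x "- y" z] cip_add(2)[of x y "- z"] by simp_all

lemma cip_commute: "cip y x = cnj (cip x y)"
  by (simp add: cip_def mult.commute)

lemma cip_self_eq_0_iff: "cip x x = 0 \<longleftrightarrow> x = 0"
proof
  assume "cip x x = 0"
  moreover have "cip x x = of_real (\<Sum>i\<in>UNIV. (cmod (x $ i))\<^sup>2)"
    unfolding cip_def of_real_sum
    by (intro sum.cong refl) (simp add: complex_norm_square[symmetric] mult.commute[of "cnj _"])
  ultimately have "(\<Sum>i\<in>UNIV. (cmod (x $ i))\<^sup>2) = 0"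
    by (metis of_real_eq_0_iff)
  then show "x = 0"
    by (subst (asm) sum_nonneg_eq_0_iff) (auto simp: vec_eq_iff)
qed simp

lemma cip_mat: "cip (A *v x) y = cip x (conj_transpose A *v y)"
proof -
  have "cip (A *v x) y = (\<Sum>i\<in>UNIV. \<Sum>j\<in>UNIV. cnj (A $ i $ j) * cnj (x $ j) * y $ i)"
    by (simp add: cip_def matrix_vector_mult_def sum_distrib_right)
  also have "\<dots> = (\<Sum>j\<in>UNIV. \<Sum>i\<in>UNIV. cnj (A $ i $ j) * cnj (x $ j) * y $ i)"
    by (rule sum.swap)
  also have "\<dots> = cip x (conj_transpose A *v y)"
    by (simp add: cip_def matrix_vector_mult_def conj_transpose_def sum_distrib_left ac_simps)
  finally show ?thesis .
qed

lemma herm_form_eq_cip: "herm_form A z = cip z (A *v z)"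
  by (simp add: herm_form_def cip_def)

locale psd_weight =
  fixes \<Psi> :: "nat \<Rightarrow> complex ^ 'm ^ 'm"
  assumes psd: "pos_semidef (\<Psi> k)"
begin

lemma cip_weight_swap: "cip (\<Psi> k *v x) y = cip x (\<Psi> k *v y)"
  using psd[of k] by (simp add: cip_mat pos_semidef_def)

text \<open>In general only a semi-inner product, as \<open>\<Psi> k\<close> may have a kernel. Over
  an infinite \<open>A\<close> the sum is 0 by convention, so most laws below are free of a
  finiteness condition.\<close>

definition form :: "nat set \<Rightarrow> (nat \<Rightarrow> complex ^ 'm) \<Rightarrow> (nat \<Rightarrow> complex ^ 'm) \<Rightarrow> complex" where
  "form A x y = (\<Sum>k\<in>A. cip (x k) (\<Psi> k *v y k))"

lemma form_add: "form A (\<lambda>k. x k + y k) z = form A x z + form A y z"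
    "form A z (\<lambda>k. x k + y k) = form A z x + form A z y"
  by (simp_all add: form_def cip_add sum.distrib matrix_vector_right_distrib)

lemma form_scale: "form A (\<lambda>k. c *s x k) y = cnj c * form A x y"
    "form A x (\<lambda>k. c *s y k) = c * form A x y"
  by (simp_all add: form_def cip_scale sum_distrib_left vec.scale)

lemma form_minus: "form A (\<lambda>k. - x k) y = - form A x y"
    "form A x (\<lambda>k. - y k) = - form A x y"
  using form_scale(1)[of A "-1" x y] form_scale(2)[of A x "-1" y] by simp_all

lemma form_diff: "form A (\<lambda>k. x k - y k) z = form A x z - form A y z"
    "form A z (\<lambda>k. x k - y k) = form A z x - form A z y"
  using form_add(1)[of A x "\<lambda>k. - y k" z] form_add(2)[of A z x "\<lambda>k. - y k"]
  by (simp_all add: form_minus)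

lemma form_commute: "form A y x = cnj (form A x y)"
proof -
  have "cip (y k) (\<Psi> k *v x k) = cnj (cip (x k) (\<Psi> k *v y k))" for k
    by (metis cip_commute cip_weight_swap)
  then show ?thesis by (simp add: form_def)
qed

lemma form_self_nonneg: "0 \<le> Re (form A x x)"
  using psd by (auto simp: form_def pos_semidef_def herm_form_eq_cip intro!: sum_nonneg)

lemma form_self_real: "form A x x = of_real (Re (form A x x))"
  by (metis form_commute complex_cnj_cancel_iff Reals_cnj_iff complex_is_Real_iff complex_eq_iff Re_complex_of_real Im_complex_of_real)

lemma form_union:
  "finite A \<Longrightarrow> finite B \<Longrightarrow> A \<inter> B = {} \<Longrightarrow> form (A \<union> B) x y = form A x y + form B x y"
  by (simp add: form_def sum.union_disjoint)

lemma form_self_mono: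
  assumes "A \<subseteq> B" "finite B" shows "Re (form A x x) \<le> Re (form B x x)"
  using form_union[of A "B - A" x x] form_self_nonneg[of "B - A" x] assms
  by (simp add: finite_subset Un_absorb1)

text \<open>The form is nonnegative at \<open>t x - s cnj c y\<close>, where the factor
  \<open>cnj c\<close> makes the mixed terms real. The choice \<open>t = b\<close>,
  \<open>s = 1\<close> settles \<open>b \<noteq> 0\<close>; for \<open>b = 0\<close> a large
  \<open>s\<close> refutes \<open>c \<noteq> 0\<close>.\<close>

lemma form_Cauchy_Schwarz: "(cmod (form A x y))\<^sup>2 \<le> Re (form A x x) * Re (form A y y)"
proof -
  define a b c where "a = Re (form A x x)" and "b = Re (form A y y)" and "c = form A x y"
  have a: "form A x x = of_real a" and b: "form A y y = of_real b" and c: "form A y x = cnj c"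
    by (auto simp: a_def b_def c_def form_self_real[symmetric] form_commute[of A y x])
  have a0: "a \<ge> 0" "b \<ge> 0" by (auto simp: a_def b_def form_self_nonneg)
  have key: "0 \<le> a * t\<^sup>2 - 2 * t * s * (cmod c)\<^sup>2 + s\<^sup>2 * (cmod c)\<^sup>2 * b" for t s :: real
  proof -
    let ?w = "\<lambda>k. of_real t *s x k - (of_real s * cnj c) *s y k"
    have "form A ?w ?w = of_real (a * t\<^sup>2 - 2 * t * s * (cmod c)\<^sup>2 + s\<^sup>2 * (cmod c)\<^sup>2 * b)"
    proof -
      have "form A ?w ?w = of_real (a * t\<^sup>2) - of_real (2 * t * s) * (c * cnj c)
          + of_real (s\<^sup>2 * b) * (c * cnj c)"
        unfolding form_diff form_scale a b c c_def[symmetric]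
        by (simp add: power2_eq_square algebra_simps)
      also have "c * cnj c = of_real ((cmod c)\<^sup>2)" by (simp add: complex_norm_square[symmetric])
      finally show ?thesis by (simp add: algebra_simps)
    qed
    then show ?thesis using form_self_nonneg[of A ?w] by simp
  qed
  show ?thesis
  proof (cases "c = 0")
    case True then show ?thesis using a0 by (simp add: a_def b_def c_def)
  next
    case False
    then have c0: "(cmod c)\<^sup>2 > 0" by simp
    show ?thesis
    proof (cases "b = 0")
      case True
      have "0 \<le> a - 2 * ((a + 1) / (2 * (cmod c)\<^sup>2)) * (cmod c)\<^sup>2"
        using key[of 1 "(a + 1) / (2 * (cmod c)\<^sup>2)"] True by simp
      then show ?thesis using c0 False by simp
    next
      case bn: False
      have "0 \<le> a * b\<^sup>2 - b * (cmod c)\<^sup>2"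
        using key[of b 1] by (simp add: power2_eq_square algebra_simps)
      then have "0 \<le> b * (a * b - (cmod c)\<^sup>2)" by (simp add: power2_eq_square algebra_simps)
      then show ?thesis using bn a0 by (simp add: zero_le_mult_iff a_def b_def c_def)
    qed
  qed
qed

lemma form_le: "cmod (form A x y) \<le> sqrt (Re (form A x x)) * sqrt (Re (form A y y))"
  using form_Cauchy_Schwarz[of A x y] by (metis real_sqrt_le_mono real_sqrt_mult real_sqrt_unique norm_ge_zero)

lemma form_eq_0: "Re (form A x x) = 0 \<Longrightarrow> form A x y = 0"
  using form_Cauchy_Schwarz[of A x y] by simp

text \<open>Cauchy--Schwarz on a one-point window, with \<open>\<Psi> k *v v\<close> as second
  argument, makes the squared length of \<open>\<Psi> k *v v\<close> vanish.\<close>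

lemma weight_mult_eq_0_iff: "\<Psi> k *v v = 0 \<longleftrightarrow> Re (herm_form (\<Psi> k) v) = 0"
proof
  assume *: "Re (herm_form (\<Psi> k) v) = 0"
  have "form {k} (\<lambda>_. v) (\<lambda>_. \<Psi> k *v v) = 0"
    using * by (intro form_eq_0) (simp add: form_def herm_form_eq_cip)
  then show "\<Psi> k *v v = 0"
    using cip_weight_swap[of k v "\<Psi> k *v v"] by (simp add: form_def cip_self_eq_0_iff)
qed (simp add: herm_form_eq_cip)

text \<open>
  Gram--Schmidt for the semidefinite form: for null vectors the quotient below is \<open>0 / 0 = 0\<close>.
\<close>

lemma projection_exists:
  fixes R :: "complex ^ 'v::finite \<Rightarrow> nat \<Rightarrow> complex ^ 'm"
  assumes add: "\<And>x y k. R (x + y) k = R x k + R y k"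
    and scale: "\<And>c x k. R (c *s x) k = c *s R x k"
  obtains \<xi> where "\<And>\<eta>. form A (R \<eta>) (\<lambda>k. z k - R \<xi> k) = 0"
proof -
  have diff: "R (x - y) k = R x k - R y k" for x y k
    using add[of x "(-1) *s y" k] scale[of "-1" y k] by simp
  have R0: "R 0 k = 0" for k using diff[of 0 0 k] by simp
  have orth: "form A (R \<eta>) w = 0" if "\<forall>c\<in>B. form A (R c) w = 0" "\<eta> \<in> vec.span B" for B w \<eta>
  proof -
    have "vec.subspace {c. form A (R c) w = 0}"
      using form_add(1)[of A "R x" "R y" w for x y] form_scale(1)[of A c "R x" w for c x]
      by (intro vec.subspaceI) (auto simp: add[abs_def] scale[abs_def] R0 form_def[of _ "R 0"])
    then show ?thesis using vec.span_minimal[of B "{c. form A (R c) w = 0}"] that by auto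
  qed
  have *: "\<exists>\<xi>\<in>vec.span B. \<forall>b\<in>B. form A (R b) (\<lambda>k. z k - R \<xi> k) = 0" if "finite B" for B z
    using that
  proof (induction B arbitrary: z rule: finite_induct)
    case (insert b B)
    obtain \<xi> where \<xi>: "\<xi> \<in> vec.span B" "\<forall>c\<in>B. form A (R c) (\<lambda>k. z k - R \<xi> k) = 0"
      using insert.IH by blast
    obtain \<eta> where \<eta>: "\<eta> \<in> vec.span B" "\<forall>c\<in>B. form A (R c) (\<lambda>k. R b k - R \<eta> k) = 0"
      using insert.IH by blast
    let ?z = "\<lambda>k. z k - R \<xi> k" and ?a = "R (b - \<eta>)"
    define t where "t = form A ?a ?z / form A ?a ?a"
    have a: "?a = (\<lambda>k. R b k - R \<eta> k)" by (simp add: fun_eq_iff diff)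
    have t: "t * form A ?a ?a = form A ?a ?z"
      using form_eq_0[of A ?a ?z] by (auto simp: t_def)
    \<comment> \<open>\<open>?a\<close> is orthogonal to the images of \<open>B\<close>, so a
      multiple of it repairs the condition for \<open>b\<close> without disturbing those for
      \<open>B\<close>.\<close>
    let ?\<zeta> = "\<xi> + t *s (b - \<eta>)"
    have w: "(\<lambda>k. z k - R ?\<zeta> k) = (\<lambda>k. ?z k - t *s ?a k)"
      by (simp only: fun_eq_iff add scale diff_diff_eq) simp
    have B: "\<forall>c\<in>B. form A (R c) (\<lambda>k. z k - R ?\<zeta> k) = 0"
      using \<xi>(2) \<eta>(2) unfolding w form_diff(2)[of _ _ ?z] form_scale a by simp
    moreover have "form A ?a (\<lambda>k. z k - R ?\<zeta> k) = 0"
      unfolding w form_diff(2)[of _ _ ?z] form_scale t by simp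
    then have "form A (R b) (\<lambda>k. z k - R ?\<zeta> k) = 0"
      using orth[OF B \<eta>(1)] unfolding a form_diff(1)[of _ "R b"] by simp
    moreover have "?\<zeta> \<in> vec.span (insert b B)"
    proof -
      have "vec.span B \<subseteq> vec.span (insert b B)" by (intro vec.span_mono) auto
      moreover have "b \<in> vec.span (insert b B)" by (intro vec.span_base) auto
      ultimately show ?thesis using \<xi>(1) \<eta>(1)
        by (intro vec.span_add vec.span_scale vec.span_diff) auto
    qed
    ultimately show ?case by blast
  qed auto
  obtain \<xi> where \<xi>: "\<forall>b\<in>cart_basis. form A (R b) (\<lambda>k. z k - R \<xi> k) = 0"
    using *[OF finite_cart_basis] by blast
  have "form A (R \<eta>) (\<lambda>k. z k - R \<xi> k) = 0" for \<eta>
    using orth[OF \<xi>] by (simp add: span_cart_basis)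
  then show ?thesis using that by blast
qed

end

section \<open>Weighted sequence spaces\<close>

context psd_weight
begin

lemma herm_form_nonneg: "0 \<le> Re (herm_form (\<Psi> k) v)"
  using psd[of k] by (simp add: pos_semidef_def)

lemma Re_form_self: "Re (form A x x) = (\<Sum>k\<in>A. Re (herm_form (\<Psi> k) (x k)))"
  by (simp add: form_def herm_form_eq_cip)

lemma psi_norm_sq_eq_0_iff: "psi_norm_sq \<Psi> z = 0 \<longleftrightarrow> (\<forall>k. \<Psi> k *v z k = 0)"
  unfolding psi_norm_sq_def using herm_form_nonneg
  by (subst suminf_eq_zero_iff) (auto simp: weight_mult_eq_0_iff ennreal_eq_0_iff antisym)

lemma l2_iff_summable: "z \<in> l2_psi \<Psi> \<longleftrightarrow> summable (\<lambda>k. Re (herm_form (\<Psi> k) (z k)))"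
  using summable_suminf_not_top[of "\<lambda>k. Re (herm_form (\<Psi> k) (z k))", OF herm_form_nonneg]
    suminf_ennreal2[of "\<lambda>k. Re (herm_form (\<Psi> k) (z k))", OF herm_form_nonneg]
  by (auto simp: l2_psi_def psi_norm_sq_def less_top)

lemma l2_form_le:
  assumes "z \<in> l2_psi \<Psi>" "finite A"
  shows "Re (form A z z) \<le> (\<Sum>k. Re (herm_form (\<Psi> k) (z k)))"
  unfolding Re_form_self using assms
  by (intro sum_le_suminf) (auto simp: l2_iff_summable herm_form_nonneg)

lemma l2_boundedI:
  assumes "\<And>N. Re (form {..<N} z z) \<le> B"
  shows "z \<in> l2_psi \<Psi>"
  unfolding l2_iff_summable using assms
  by (intro summableI_nonneg_bounded[of _ B]) (auto simp: Re_form_self herm_form_nonneg)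

text \<open>The parallelogram law, with the nonnegative difference term dropped.\<close>

lemma l2_add:
  assumes "x \<in> l2_psi \<Psi>" "y \<in> l2_psi \<Psi>"
  shows "(\<lambda>k. x k + y k) \<in> l2_psi \<Psi>"
proof (rule l2_boundedI)
  fix N
  have "Re (form {..<N} (\<lambda>k. x k + y k) (\<lambda>k. x k + y k)) + Re (form {..<N} (\<lambda>k. x k - y k) (\<lambda>k. x k - y k))
      = 2 * Re (form {..<N} x x) + 2 * Re (form {..<N} y y)"
    by (simp add: form_add form_diff)
  then show "Re (form {..<N} (\<lambda>k. x k + y k) (\<lambda>k. x k + y k))
      \<le> 2 * (\<Sum>k. Re (herm_form (\<Psi> k) (x k))) + 2 * (\<Sum>k. Re (herm_form (\<Psi> k) (y k)))"
    using l2_form_le[OF assms(1), of "{..<N}"] l2_form_le[OF assms(2), of "{..<N}"]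
      form_self_nonneg[of "{..<N}" "\<lambda>k. x k - y k"] by simp
qed

lemma l2_scale:
  assumes "x \<in> l2_psi \<Psi>"
  shows "(\<lambda>k. c *s x k) \<in> l2_psi \<Psi>"
proof (rule l2_boundedI)
  fix N
  have "form {..<N} (\<lambda>k. c *s x k) (\<lambda>k. c *s x k) = of_real ((cmod c)\<^sup>2) * form {..<N} x x"
    unfolding form_scale complex_norm_square by simp
  then show "Re (form {..<N} (\<lambda>k. c *s x k) (\<lambda>k. c *s x k))
      \<le> (cmod c)\<^sup>2 * (\<Sum>k. Re (herm_form (\<Psi> k) (x k)))"
    using l2_form_le[OF assms(1), of "{..<N}"] by (simp add: mult_left_mono)
qed

lemma l2_zero: "(\<lambda>k. 0) \<in> l2_psi \<Psi>"
  by (rule l2_boundedI[of _ 0]) (simp add: form_def)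

text \<open>Cauchy--Schwarz at each index and the inequality of arithmetic and geometric means bound
  the terms by a sum of two summable sequences.\<close>

lemma summable_pairing:
  assumes "x \<in> l2_psi \<Psi>" "y \<in> l2_psi \<Psi>"
  shows "summable (\<lambda>k. cip (x k) (\<Psi> k *v y k))"
proof (rule summable_comparison_test)
  show "summable (\<lambda>k. Re (herm_form (\<Psi> k) (x k)) + Re (herm_form (\<Psi> k) (y k)))"
    using assms by (intro summable_add) (simp_all add: l2_iff_summable)
  have "norm (cip (x k) (\<Psi> k *v y k)) \<le> Re (herm_form (\<Psi> k) (x k)) + Re (herm_form (\<Psi> k) (y k))" for k
  proof -
    let ?p = "Re (herm_form (\<Psi> k) (x k))" and ?q = "Re (herm_form (\<Psi> k) (y k))"
    have "norm (cip (x k) (\<Psi> k *v y k)) \<le> sqrt ?p * sqrt ?q"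
      using form_le[of "{k}" x y] by (simp add: form_def herm_form_eq_cip)
    also have "\<dots> = sqrt (?p * ?q)" by (simp add: real_sqrt_mult)
    also have "\<dots> \<le> (?p + ?q) / 2"
      by (rule arith_geo_mean_sqrt) (rule herm_form_nonneg)+
    finally show ?thesis using herm_form_nonneg[of k "x k"] herm_form_nonneg[of k "y k"] by simp
  qed
  then show "\<exists>N. \<forall>k\<ge>N. norm (cip (x k) (\<Psi> k *v y k))
      \<le> Re (herm_form (\<Psi> k) (x k)) + Re (herm_form (\<Psi> k) (y k))" by blast
qed

definition pairing :: "(nat \<Rightarrow> complex ^ 'm) \<Rightarrow> (nat \<Rightarrow> complex ^ 'm) \<Rightarrow> complex" where
  "pairing x y = (\<Sum>k. cip (x k) (\<Psi> k *v y k))"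

lemma pairing_LIMSEQ:
  "x \<in> l2_psi \<Psi> \<Longrightarrow> y \<in> l2_psi \<Psi> \<Longrightarrow> (\<lambda>N. form {..<N} x y) \<longlonglongrightarrow> pairing x y"
  unfolding form_def pairing_def by (rule summable_LIMSEQ[OF summable_pairing])

lemma pairing_add:
  assumes "x \<in> l2_psi \<Psi>" "y \<in> l2_psi \<Psi>" "z \<in> l2_psi \<Psi>"
  shows "pairing (\<lambda>k. x k + y k) z = pairing x z + pairing y z"
    and "pairing z (\<lambda>k. x k + y k) = pairing z x + pairing z y"
  using assms unfolding pairing_def
  by (simp_all add: cip_add matrix_vector_right_distrib suminf_add[OF summable_pairing summable_pairing])

lemma pairing_scale:
  assumes "x \<in> l2_psi \<Psi>" "y \<in> l2_psi \<Psi>"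
  shows "pairing (\<lambda>k. c *s x k) y = cnj c * pairing x y"
    and "pairing x (\<lambda>k. c *s y k) = c * pairing x y"
  using assms unfolding pairing_def
  by (simp_all add: cip_scale vec.scale suminf_mult[OF summable_pairing])

section \<open>The quotient by sequences of norm zero\<close>

lemma psi_rel_iff:
  "(z, w) \<in> psi_rel \<Psi> \<longleftrightarrow> z \<in> l2_psi \<Psi> \<and> w \<in> l2_psi \<Psi> \<and> (\<forall>k. \<Psi> k *v z k = \<Psi> k *v w k)"
  by (simp add: psi_rel_def psi_norm_sq_eq_0_iff matrix_vector_mult_diff_distrib)

lemma mem_psi_class_iff:
  "w \<in> psi_class \<Psi> z \<longleftrightarrow> z \<in> l2_psi \<Psi> \<and> w \<in> l2_psi \<Psi> \<and> (\<forall>k. \<Psi> k *v z k = \<Psi> k *v w k)"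
  by (simp add: psi_class_def psi_rel_iff)

lemma psi_class_eq_iff:
  assumes "z \<in> l2_psi \<Psi>" "w \<in> l2_psi \<Psi>"
  shows "psi_class \<Psi> z = psi_class \<Psi> w \<longleftrightarrow> (\<forall>k. \<Psi> k *v z k = \<Psi> k *v w k)"
  using assms by (auto simp: set_eq_iff mem_psi_class_iff)

lemma carrier_l2_quot: "carrier (l2_quot \<Psi>) = psi_class \<Psi> ` l2_psi \<Psi>"
  by (auto simp: l2_quot_def quotient_def psi_class_def)

text \<open>The class of a sum is independent of the representatives, so the double union in
  \<open>l2_quot_def\<close> has equal members; it collapses because classes of elements of
  \<open>l2_psi\<close> are nonempty.\<close>

lemma add_l2_quot:
  assumes "x \<in> l2_psi \<Psi>" "y \<in> l2_psi \<Psi>"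
  shows "psi_class \<Psi> x \<oplus>\<^bsub>l2_quot \<Psi>\<^esub> psi_class \<Psi> y = psi_class \<Psi> (\<lambda>k. x k + y k)"
proof -
  have "psi_class \<Psi> (\<lambda>k. x' k + y' k) = psi_class \<Psi> (\<lambda>k. x k + y k)"
    if "x' \<in> psi_class \<Psi> x" "y' \<in> psi_class \<Psi> y" for x' y'
    using that by (subst psi_class_eq_iff) (auto simp: mem_psi_class_iff l2_add matrix_vector_right_distrib)
  then have "psi_class \<Psi> x \<oplus>\<^bsub>l2_quot \<Psi>\<^esub> psi_class \<Psi> y
      = (\<Union>x'\<in>psi_class \<Psi> x. \<Union>y'\<in>psi_class \<Psi> y. psi_class \<Psi> (\<lambda>k. x k + y k))"
    by (simp add: l2_quot_def cong: SUP_cong_simp)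
  moreover have "psi_class \<Psi> x \<noteq> {}" "psi_class \<Psi> y \<noteq> {}"
    using assms mem_psi_class_iff[of x x] mem_psi_class_iff[of y y] by blast+
  ultimately show ?thesis by simp
qed

lemma smult_l2_quot:
  assumes "x \<in> l2_psi \<Psi>"
  shows "c \<odot>\<^bsub>l2_quot \<Psi>\<^esub> psi_class \<Psi> x = psi_class \<Psi> (\<lambda>k. c *s x k)"
proof -
  have "psi_class \<Psi> (\<lambda>k. c *s x' k) = psi_class \<Psi> (\<lambda>k. c *s x k)"
    if "x' \<in> psi_class \<Psi> x" for x'
    using that by (subst psi_class_eq_iff) (auto simp: mem_psi_class_iff l2_scale vec.scale)
  then have "c \<odot>\<^bsub>l2_quot \<Psi>\<^esub> psi_class \<Psi> x = (\<Union>x'\<in>psi_class \<Psi> x. psi_class \<Psi> (\<lambda>k. c *s x k))"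
    by (simp add: l2_quot_def cong: SUP_cong_simp)
  moreover have "psi_class \<Psi> x \<noteq> {}"
    using assms mem_psi_class_iff[of x x] by blast
  ultimately show ?thesis by simp
qed

end

section \<open>Algebra of the matrix J\<close>

lemma sum_UNIV_Plus: "(\<Sum>k\<in>UNIV. f k) = (\<Sum>a\<in>UNIV. f (Inl a)) + (\<Sum>b\<in>UNIV. f (Inr b))"
  for f :: "'n::finite + 'n \<Rightarrow> complex"
  using sum.Plus[of "UNIV :: 'n set" "UNIV :: 'n set" f] by (simp add: o_def)

lemma J_mat_vec_nth:
  "(J_mat *v x) $ Inl a = x $ Inr a" "(J_mat *v x) $ Inr a = - x $ Inl a"
  for x :: "('n::finite) cvec"
proof -
  have "(\<Sum>b\<in>UNIV. (if a = b then 1 else 0) * x $ Inr b) = x $ Inr a"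
    "(\<Sum>b\<in>UNIV. (if a = b then - 1 else 0) * x $ Inl b) = - x $ Inl a"
    by (simp_all add: if_distrib[of "\<lambda>u. u * _"] cong: if_cong)
  then show "(J_mat *v x) $ Inl a = x $ Inr a" "(J_mat *v x) $ Inr a = - x $ Inl a"
    by (simp_all add: matrix_vector_mult_def sum_UNIV_Plus J_mat_def)
qed

lemma conj_transpose_J_mat: "conj_transpose J_mat = - (J_mat :: ('n::finite) cmat)"
proof -
  have "cnj (J_mat $ j $ i) = - (J_mat $ i $ j)" for i j :: "'n + 'n"
    by (cases i; cases j) (auto simp: J_mat_def)
  then show ?thesis by (simp add: vec_eq_iff conj_transpose_def)
qed

lemma uminus_mult_vec: "(- A) *v x = - (A *v (x :: complex ^ 'n))"
  by (simp add: vec_eq_iff matrix_vector_mult_def sum_negf)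

lemma J_mat_J_mat_vec [simp]: "J_mat *v (J_mat *v x) = - (x :: ('n::finite) cvec)"
proof -
  have "(J_mat *v (J_mat *v x)) $ i = - x $ i" for i
    by (cases i) (simp_all add: J_mat_vec_nth)
  then show ?thesis by (simp add: vec_eq_iff)
qed

lemma cip_J_mat: "cip (J_mat *v x) y = - cip x (J_mat *v (y :: ('n::finite) cvec))"
  by (simp add: cip_mat conj_transpose_J_mat uminus_mult_vec)

section \<open>Symplectic systems\<close>

lemma continuous_on_mat_vec [continuous_intros]:
  "continuous_on X f \<Longrightarrow> continuous_on X (\<lambda>x. (A :: complex ^ 'm ^ 'k) *v f x)"
  unfolding matrix_vector_mult_def by (intro continuous_intros)

lemma continuous_on_vec_scale [continuous_intros]:
  "continuous_on X f \<Longrightarrow> continuous_on X (\<lambda>x. (c :: complex) *s (f x :: complex ^ 'm))"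
  unfolding vector_scalar_mult_def by (intro continuous_intros)

lemma continuous_on_cip [continuous_intros]:
  "continuous_on X f \<Longrightarrow> continuous_on X g \<Longrightarrow> continuous_on X (\<lambda>x. cip (f x) (g x))"
  unfolding cip_def by (intro continuous_intros)

locale symplectic_system = psd_weight \<Psi> for \<Psi> :: "nat \<Rightarrow> ('n::finite) cmat" +
  fixes S :: "nat \<Rightarrow> 'n cmat"
  assumes symplectic: "conj_transpose (S k) ** J_mat ** S k = J_mat"
    and weight_J_weight: "\<Psi> k ** J_mat ** \<Psi> k = 0"
begin

lemma weight_J_weight_vec [simp]: "\<Psi> k *v (J_mat *v (\<Psi> k *v x)) = 0"
  using weight_J_weight[of k] by (simp add: matrix_vector_mul_assoc matrix_mul_assoc)

lemma symplectic_vec: "conj_transpose (S k) *v (J_mat *v (S k *v x)) = J_mat *v x"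
  using symplectic[of k] by (simp add: matrix_vector_mul_assoc matrix_mul_assoc)

text \<open>The inverse of a symplectic matrix, read off from \<open>S\<^sup>* J S = J\<close> and
  \<open>J\<^sup>2 = - 1\<close>.\<close>

definition S_inv :: "nat \<Rightarrow> 'n cmat" where
  "S_inv k = - (J_mat ** conj_transpose (S k) ** J_mat)"

lemma S_inv_S [simp]: "S_inv k *v (S k *v x) = x"
proof -
  have "S_inv k *v (S k *v x) = - (J_mat *v (conj_transpose (S k) *v (J_mat *v (S k *v x))))"
    unfolding S_inv_def uminus_mult_vec by (simp add: matrix_vector_mul_assoc matrix_mul_assoc)
  then show ?thesis by (simp only: symplectic_vec J_mat_J_mat_vec minus_minus)
qed

lemma S_S_inv [simp]: "S k *v (S_inv k *v x) = x"
proof -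
  have "S_inv k ** S k = mat 1"
    by (simp add: matrix_eq matrix_vector_mul_assoc[symmetric])
  then have "S k ** S_inv k = mat 1" using matrix_left_right_inverse by blast
  then show ?thesis by (simp add: matrix_vector_mul_assoc)
qed

section \<open>Solutions and their initial values\<close>

lemma L_op_eq_iff: "L_op S z k = w \<longleftrightarrow> S k *v z (Suc k) = z k + J_mat *v w"
proof
  assume "L_op S z k = w"
  then have "J_mat *v w = J_mat *v (J_mat *v (z k - S k *v z (Suc k)))"
    by (simp add: L_op_def)
  then show "S k *v z (Suc k) = z k + J_mat *v w" by simp
qed (simp add: L_op_def vec.neg)

text \<open>\<open>S_lam\<close> expresses each term by its successor. The equation with
  \<open>L_op\<close> is solved for the successor by \<open>S_inv\<close> alone, so no inverse of
  \<open>S_lam\<close> enters.\<close>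

primrec sol :: "complex \<Rightarrow> 'n cvec \<Rightarrow> nat \<Rightarrow> 'n cvec" where
  "sol l \<xi> 0 = \<xi>"
| "sol l \<xi> (Suc k) = S_inv k *v (sol l \<xi> k + l *s (J_mat *v (\<Psi> k *v sol l \<xi> k)))"

lemma sol_add: "sol l (x + y) k = sol l x k + sol l y k"
  by (induction k) (simp_all add: matrix_vector_right_distrib vec.scale_right_distrib ac_simps)

lemma sol_scale: "sol l (c *s x) k = c *s sol l x k"
  by (induction k) (simp_all add: matrix_vector_right_distrib vec.scale_right_distrib vec.scale ac_simps)

lemma sol_zero [simp]: "sol l 0 k = 0"
  using sol_scale[of l 0 0 k] by simp

lemma continuous_on_sol [continuous_intros]: "continuous_on X (\<lambda>x. sol l x k)"
  by (induction k) (auto intro!: continuous_intros)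

lemma continuous_on_form_sol [continuous_intros]:
  "continuous_on X (\<lambda>x. form A (sol l x) (sol l x))" "continuous_on X (\<lambda>x. form A (sol l x) z)"
  unfolding form_def by (intro continuous_intros)+

lemma sol_step: "S k *v sol l \<xi> (Suc k) = sol l \<xi> k + J_mat *v (\<Psi> k *v (l *s sol l \<xi> k))"
  by (simp add: vec.scale)

lemma L_op_eq_iff_sol: "(\<forall>k. L_op S z k = l *s (\<Psi> k *v z k)) \<longleftrightarrow> z = sol l (z 0)"
proof
  assume *: "\<forall>k. L_op S z k = l *s (\<Psi> k *v z k)"
  have "z k = sol l (z 0) k" for k
  proof (induction k)
    case (Suc k)
    have "z (Suc k) = S_inv k *v (S k *v z (Suc k))" by simp
    also have "S k *v z (Suc k) = z k + J_mat *v (l *s (\<Psi> k *v z k))"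
      using * by (simp only: L_op_eq_iff)
    finally show ?case using Suc by (simp add: vec.scale)
  qed simp
  then show "z = sol l (z 0)" by blast
next
  assume *: "z = sol l (z 0)"
  show "\<forall>k. L_op S z k = l *s (\<Psi> k *v z k)"
    unfolding L_op_eq_iff using sol_step[of _ l "z 0"] * by (metis vec.scale)
qed

lemma S_lam_mult_vec: "S_lam S \<Psi> l k *v x = S k *v x - l *s (J_mat *v (\<Psi> k *v (S k *v x)))"
proof -
  have "S_lam S \<Psi> l k *v x = S k *v x + l *s (V_mat S \<Psi> k *v x)"
    by (simp add: S_lam_def vec_eq_iff matrix_vector_mult_def algebra_simps sum.distrib sum_distrib_left)
  then show ?thesis
    by (simp add: V_mat_def uminus_mult_vec matrix_vector_mul_assoc matrix_mul_assoc)
qed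

text \<open>In one equation the weight acts on \<open>S k *v z (Suc k)\<close>, in the other on
  \<open>z k\<close>. These differ by a vector in the range of \<open>J_mat ** \<Psi> k\<close>,
  which \<open>\<Psi> k\<close> annihilates.\<close>

lemma is_solution_iff: "is_solution S \<Psi> l z \<longleftrightarrow> z = sol l (z 0)"
proof -
  have "z k = S_lam S \<Psi> l k *v z (Suc k) \<longleftrightarrow> L_op S z k = l *s (\<Psi> k *v z k)" for k
  proof -
    let ?w = "S k *v z (Suc k)"
    have "z k = ?w - l *s (J_mat *v (\<Psi> k *v ?w)) \<longleftrightarrow> ?w = z k + l *s (J_mat *v (\<Psi> k *v z k))"
    proof
      assume z: "z k = ?w - l *s (J_mat *v (\<Psi> k *v ?w))"
      have "\<Psi> k *v z k = \<Psi> k *v ?w"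
        by (subst z) (simp add: matrix_vector_mult_diff_distrib vec.scale)
      then show "?w = z k + l *s (J_mat *v (\<Psi> k *v z k))" using z by simp
    next
      assume w: "?w = z k + l *s (J_mat *v (\<Psi> k *v z k))"
      have "\<Psi> k *v ?w = \<Psi> k *v z k"
        by (subst w) (simp add: matrix_vector_right_distrib vec.scale)
      then show "z k = ?w - l *s (J_mat *v (\<Psi> k *v ?w))" using w by simp
    qed
    then show ?thesis by (simp add: S_lam_mult_vec L_op_eq_iff vec.scale)
  qed
  then show ?thesis unfolding is_solution_def L_op_eq_iff_sol[symmetric] by simp
qed

lemma sol_surj: "\<exists>\<xi>. sol l \<xi> N = v"
proof (induction N arbitrary: v)
  case (Suc N)
  define w where "w = S N *v v"
  \<comment> \<open>The vector on the right is \<open>S_lam S \<Psi> l N *v v\<close>, the term that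
    precedes \<open>v\<close> in a solution.\<close>
  obtain \<xi> where \<xi>: "sol l \<xi> N = w - l *s (J_mat *v (\<Psi> N *v w))" using Suc by blast
  have "sol l \<xi> (Suc N) = v"
    by (simp add: \<xi> matrix_vector_mult_diff_distrib vec.scale) (simp add: w_def)
  then show ?case ..
qed simp

section \<open>Green's identity and the bound for the projection defect\<close>

lemma cip_J_cip_J: "cip (J_mat *v x) (J_mat *v y) = cip x (y :: 'n cvec)"
  by (simp add: cip_J_mat)

text \<open>One step changes the J-form by two weighted terms only: \<open>symplectic_vec\<close>
  removes \<open>S\<close>, and the product of the two increments vanishes by
  \<open>weight_J_weight\<close>.\<close>

lemma Green:
  assumes y: "\<And>k. S k *v y (Suc k) = y k + J_mat *v (\<Psi> k *v g k)"
    and z: "\<And>k. S k *v z (Suc k) = z k + J_mat *v (\<Psi> k *v h k)"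
  shows "cip (y N) (J_mat *v z N) - cip (y 0) (J_mat *v z 0) = form {..<N} g z - form {..<N} y h"
proof (induction N)
  case (Suc N)
  have "cip (y (Suc N)) (J_mat *v z (Suc N)) = cip (S N *v y (Suc N)) (J_mat *v (S N *v z (Suc N)))"
    by (simp add: cip_mat symplectic_vec)
  also have "\<dots> = cip (y N) (J_mat *v z N) + cip (g N) (\<Psi> N *v z N) - cip (y N) (\<Psi> N *v h N)"
    unfolding y z
    by (simp add: matrix_vector_right_distrib cip_add cip_J_cip_J)
      (simp add: cip_J_mat cip_weight_swap cip_diff matrix_vector_mult_diff_distrib vec.neg)
  finally show ?case using Suc by (simp add: form_def)
qed (simp add: form_def)

text \<open>Orthogonality to the solutions for \<open>l\<close> lets \<open>f\<close> be the
  right-hand side of a problem for \<open>cnj l\<close> with zero values at both ends of the window.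
  As \<open>l\<close> is not real, its solution \<open>y\<close> is at most
  \<open>f / \<bar>Im l\<bar>\<close> in norm.\<close>

lemma orthogonal_defect_bound:
  assumes l: "Im l \<noteq> 0"
    and orth: "\<And>\<xi>. form {..<N} f (sol l \<xi>) = 0"
  shows "\<bar>Im l\<bar> * cmod (form {..<N} f (sol \<mu> \<zeta>))
    \<le> cmod (\<mu> - l) * (sqrt (Re (form {..<N} f f)) * sqrt (Re (form {..<N} (sol \<mu> \<zeta>) (sol \<mu> \<zeta>))))"
proof -
  \<comment> \<open>The parameter is \<open>cnj l\<close> because the form is conjugate-linear in
    its first argument: against a solution for \<open>l\<close> the terms with \<open>y\<close> then
    cancel in Green's identity.\<close>
  define y where "y = rec_nat 0 (\<lambda>k v. S_inv k *v (v + J_mat *v (\<Psi> k *v (cnj l *s v + f k))))"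
  define g where "g = (\<lambda>k. cnj l *s y k + f k)"
  let ?F = "form {..<N}"
  have y0: "y 0 = 0" by (simp add: y_def)
  have y: "S k *v y (Suc k) = y k + J_mat *v (\<Psi> k *v g k)" for k
    by (simp add: y_def g_def)
  have Fg: "?F g x = l * ?F y x + ?F f x" "?F x g = cnj l * ?F x y + ?F x f" for x
    unfolding g_def form_add form_scale by simp_all
  have "cip (y N) (J_mat *v sol l \<xi> N) = 0" for \<xi>
    using Green[OF y sol_step[of _ l \<xi>], where N = N] by (simp add: y0 Fg orth form_scale)
  then have "cip (y N) (J_mat *v v) = 0" for v using sol_surj by metis
  \<comment> \<open>This choice gives \<open>J_mat *v v = y N\<close>.\<close>
  from this[of "- (J_mat *v y N)"] have "cip (y N) (y N) = 0"
    by (simp add: vec.neg)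
  then have yN: "y N = 0" by (simp add: cip_self_eq_0_iff)
  let ?Y = "sqrt (Re (?F y y))" and ?f = "sqrt (Re (?F f f))" and ?z = "sol \<mu> \<zeta>"
  \<comment> \<open>Green's identity for \<open>y\<close> with itself; both boundary terms are zero,
    and the imaginary part of \<open>l\<close> survives.\<close>
  have "0 = l * ?F y y + ?F f y - (cnj l * ?F y y + ?F y f)"
    using Green[OF y y, where N = N] by (simp add: y0 yN Fg)
  then have "(l - cnj l) * ?F y y = ?F y f - ?F f y" by (simp add: algebra_simps)
  then have "cmod (l - cnj l) * cmod (?F y y) = cmod (?F y f - ?F f y)"
    by (metis norm_mult)
  also have "\<dots> \<le> 2 * cmod (?F f y)"
    using norm_triangle_ineq4[of "?F y f" "?F f y"] by (simp add: form_commute[of _ y f])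
  also have "\<dots> \<le> 2 * (?f * ?Y)" using form_le by simp
  also have "cmod (l - cnj l) = 2 * \<bar>Im l\<bar>" by (simp add: complex_diff_cnj norm_mult)
  also have "cmod (?F y y) = ?Y * ?Y"
    using form_self_nonneg by (subst form_self_real) simp
  finally have "?Y * (\<bar>Im l\<bar> * ?Y) \<le> ?Y * ?f" by (simp add: ac_simps)
  \<comment> \<open>Division by \<open>?Y\<close>; for \<open>?Y = 0\<close> only
    \<open>0 \<le> ?f\<close> remains.\<close>
  then have Y: "\<bar>Im l\<bar> * ?Y \<le> ?f"
    using form_self_nonneg[of "{..<N}" y] form_self_nonneg[of "{..<N}" f]
    by (cases "?Y = 0") auto
  have "0 = l * ?F y ?z + ?F f ?z - \<mu> * ?F y ?z"
    using Green[OF y sol_step[of _ \<mu> \<zeta>], where N = N] by (simp add: y0 yN Fg form_scale)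
  then have "?F f ?z = (\<mu> - l) * ?F y ?z" by (simp add: algebra_simps)
  then have "\<bar>Im l\<bar> * cmod (?F f ?z) = cmod (\<mu> - l) * (\<bar>Im l\<bar> * cmod (?F y ?z))"
    by (simp add: norm_mult)
  also have "\<dots> \<le> cmod (\<mu> - l) * (\<bar>Im l\<bar> * (?Y * sqrt (Re (?F ?z ?z))))"
    by (intro mult_left_mono form_le) auto
  also have "\<dots> \<le> cmod (\<mu> - l) * (?f * sqrt (Re (?F ?z ?z)))"
    using mult_right_mono[OF Y, of "sqrt (Re (?F ?z ?z))"] form_self_nonneg[of "{..<N}" ?z]
    by (intro mult_left_mono) (auto simp: ac_simps)
  finally show ?thesis .
qed

text \<open>The space \<open>K\<close> of the overview, in terms of initial values. The parameter 0
  is an arbitrary choice by \<open>null_init_iff\<close>.\<close>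

definition null_init :: "'n cvec set" where
  "null_init = {\<xi>. \<forall>k. \<Psi> k *v sol 0 \<xi> k = 0}"

definition l2_init :: "complex \<Rightarrow> 'n cvec set" where
  "l2_init l = {\<xi>. sol l \<xi> \<in> l2_psi \<Psi>}"

lemma null_init_iff: "\<xi> \<in> null_init \<longleftrightarrow> (\<forall>k. \<Psi> k *v sol l \<xi> k = 0)"
proof -
  have *: "sol l \<xi> k = sol m \<xi> k" if "\<forall>k. \<Psi> k *v sol l \<xi> k = 0" for k l m
  proof (induction k)
    case (Suc k)
    then have "\<Psi> k *v sol m \<xi> k = 0" using that by metis
    then show ?case using Suc that by simp
  qed simp
  show ?thesis unfolding null_init_def using *[of l _ 0] *[of 0 _ l] by auto
qed

lemma subspace_null_init: "vec.subspace null_init"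
  unfolding null_init_def
  by (rule vec.subspaceI) (auto simp: sol_add sol_scale matrix_vector_right_distrib vec.scale)

lemma subspace_l2_init: "vec.subspace (l2_init l)"
proof (rule vec.subspaceI)
  show "0 \<in> l2_init l" using l2_zero by (simp add: l2_init_def sol_zero[abs_def])
next
  fix x y assume "x \<in> l2_init l" "y \<in> l2_init l"
  then show "x + y \<in> l2_init l"
    using l2_add[of "sol l x" "sol l y"] by (simp add: l2_init_def sol_add[abs_def])
next
  fix c x assume "x \<in> l2_init l"
  then show "c *s x \<in> l2_init l"
    using l2_scale[of "sol l x" c] by (simp add: l2_init_def sol_scale[abs_def])
qed

lemma null_init_subset: "null_init \<subseteq> l2_init l"
  by (auto simp: null_init_iff[of _ l] l2_init_def form_def intro!: l2_boundedI[of _ 0])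

end

section \<open>Deficiency indices\<close>

context symplectic_system
begin

text \<open>Outside \<open>null_init\<close> every solution has positive form on some window. These
  open conditions cover the compact set of unit vectors orthogonal to \<open>null_init\<close>, so
  one window serves all of them. This bounds the initial values of the window projections.\<close>

lemma form_sol_coercive:
  obtains m c where "c > 0"
    "\<And>\<xi>. (\<forall>\<kappa>\<in>null_init. orthogonal \<xi> \<kappa>) \<Longrightarrow> c * (norm \<xi>)\<^sup>2 \<le> Re (form {..<m} (sol l \<xi>) (sol l \<xi>))"
proof -
  define q where "q m \<xi> = Re (form {..<m} (sol l \<xi>) (sol l \<xi>))" for m \<xi>
  define X where "X = sphere 0 1 \<inter> {\<xi>. \<forall>\<kappa>\<in>null_init. orthogonal \<xi> \<kappa>}"
  have cont: "continuous_on Y (q m)" for Y m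
    unfolding q_def by (intro continuous_intros)
  have mono: "q m \<xi> \<le> q m' \<xi>" if "m \<le> m'" for m m' \<xi>
    unfolding q_def using that by (intro form_self_mono) auto
  have "closed {\<xi>. \<forall>\<kappa>\<in>null_init. orthogonal \<xi> \<kappa>}"
  proof -
    have "{\<xi>. \<forall>\<kappa>\<in>null_init. orthogonal \<xi> \<kappa>} = (\<Inter>\<kappa>\<in>null_init. {\<xi>. \<xi> \<bullet> \<kappa> = 0})"
      by (auto simp: orthogonal_def)
    also have "closed \<dots>"
      by (intro closed_INT ballI closed_Collect_eq continuous_intros)
    finally show ?thesis .
  qed
  then have X: "compact X" unfolding X_def by (intro compact_Int_closed) auto
  obtain m c where mc: "c > 0" "\<And>\<xi>. \<xi> \<in> X \<Longrightarrow> c \<le> q m \<xi>"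
  proof (cases "X = {}")
    case True
    then show ?thesis using that[of 1] by auto
  next
    case False
    have "X \<subseteq> (\<Union>m. {\<xi>. 0 < q m \<xi>})"
    proof
      fix \<xi> assume \<xi>: "\<xi> \<in> X"
      have "\<xi> \<notin> null_init"
        using \<xi> by (auto simp: X_def orthogonal_def)
      then obtain k where "\<Psi> k *v sol l \<xi> k \<noteq> 0"
        by (auto simp: null_init_iff[of _ l])
      then have "0 < Re (herm_form (\<Psi> k) (sol l \<xi> k))"
        using herm_form_nonneg[of k "sol l \<xi> k"] weight_mult_eq_0_iff[of k "sol l \<xi> k"] by linarith
      also have "\<dots> \<le> q (Suc k) \<xi>"
        unfolding q_def using form_self_mono[of "{k}" "{..<Suc k}" "sol l \<xi>"]
        by (simp add: Re_form_self)
      finally show "\<xi> \<in> (\<Union>m. {\<xi>. 0 < q m \<xi>})" by auto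
    qed
    moreover have "open {\<xi>. 0 < q m \<xi>}" for m
      by (intro open_Collect_less cont continuous_on_const)
    ultimately obtain C where C: "finite C" "X \<subseteq> (\<Union>m\<in>C. {\<xi>. 0 < q m \<xi>})"
      using compactE_image[OF X, of UNIV "\<lambda>m. {\<xi>. 0 < q m \<xi>}"] by metis
    \<comment> \<open>The form grows with the window, so one above all those in \<open>C\<close> is
      positive on the whole of \<open>X\<close>.\<close>
    obtain m where m: "\<And>k. k \<in> C \<Longrightarrow> k \<le> m" using C(1) finite_nat_set_iff_bounded_le by auto
    obtain \<xi>0 where \<xi>0: "\<xi>0 \<in> X" "\<And>\<xi>. \<xi> \<in> X \<Longrightarrow> q m \<xi>0 \<le> q m \<xi>"
      using continuous_attains_inf[OF X False cont] by metis
    obtain k where "k \<in> C" "0 < q k \<xi>0" using C(2) \<xi>0(1) by blast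
    then have "q m \<xi>0 > 0" using mono[OF m, of k \<xi>0] by simp
    then show ?thesis using that \<xi>0(2) by blast
  qed
  have "c * (norm \<xi>)\<^sup>2 \<le> q m \<xi>" if \<xi>: "\<forall>\<kappa>\<in>null_init. orthogonal \<xi> \<kappa>" for \<xi>
  proof (cases "\<xi> = 0")
    case True
    then show ?thesis by (simp add: q_def form_self_nonneg)
  next
    case False
    define \<eta> where "\<eta> = inverse (norm \<xi>) *\<^sub>R \<xi>"
    have "\<eta> \<in> X" using False \<xi> by (simp add: X_def \<eta>_def orthogonal_def)
    then have "c \<le> q m \<eta>" by (rule mc)
    have "\<xi> = of_real (norm \<xi>) *s \<eta>"
      using False
      by (simp add: \<eta>_def vec_eq_iff[of \<xi> "of_real (norm \<xi>) *s _"] scaleR_conv_of_real[where 'a = complex])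
    then have "sol l \<xi> = (\<lambda>k. of_real (norm \<xi>) *s sol l \<eta> k)"
      by (metis (no_types) sol_scale ext)
    then have "form {..<m} (sol l \<xi>) (sol l \<xi>) = of_real ((norm \<xi>)\<^sup>2) * form {..<m} (sol l \<eta>) (sol l \<eta>)"
      by (simp add: form_scale power2_eq_square)
    then have "q m \<xi> = (norm \<xi>)\<^sup>2 * q m \<eta>"
      by (simp add: q_def)
    then show ?thesis using \<open>c \<le> q m \<eta>\<close> by (simp add: mult.commute mult_right_mono)
  qed
  then show ?thesis using that mc(1) unfolding q_def by blast
qed

text \<open>A summand from \<open>null_init\<close> is invisible to the weights, so it can be
  removed to reach the region where \<open>form_sol_coercive\<close> applies.\<close>

lemma orthogonal_representative:
  obtains \<omega> where "\<And>\<kappa>. \<kappa> \<in> null_init \<Longrightarrow> orthogonal \<omega> \<kappa>"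
    "\<And>k. \<Psi> k *v sol l \<omega> k = \<Psi> k *v sol l \<xi> k"
proof -
  obtain \<kappa> \<omega> where *: "\<kappa> \<in> span null_init" "\<And>w. w \<in> span null_init \<Longrightarrow> orthogonal \<omega> w" "\<xi> = \<kappa> + \<omega>"
    using orthogonal_subspace_decomp_exists[of null_init \<xi>] by metis
  \<comment> \<open>\<open>orthogonal\<close> and the decomposition refer to the real inner product,
    hence the passage to real scalars.\<close>
  have "Real_Vector_Spaces.subspace null_init"
  proof (rule real_vector.subspaceI)
    fix c x assume "x \<in> null_init"
    moreover have "c *\<^sub>R x = of_real c *s x" 
      by (simp add: vec_eq_iff) (simp add: scaleR_conv_of_real)
    ultimately show "c *\<^sub>R x \<in> null_init" using vec.subspace_scale[OF subspace_null_init] by metis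
  qed (use vec.subspace_0[OF subspace_null_init] vec.subspace_add[OF subspace_null_init] in auto)
  then have "\<kappa> \<in> null_init" using * by (simp add: span_eq_iff[THEN iffD2])
  then have "\<Psi> k *v sol l \<kappa> k = 0" for k by (simp add: null_init_iff[of _ l])
  then show ?thesis using that[of \<omega>] * 
    by (auto simp: sol_add matrix_vector_right_distrib span_base)
qed

text \<open>Compactness replaces a projection onto \<open>M_space\<close>: the initial values of the
  window projections have a limit point \<open>\<omega>0\<close>. Its pairing with \<open>z\<close>
  would have real part at least \<open>(1 - r\<^sup>2) * Z\<close>, but it is 0 by
  \<open>orth\<close>.\<close>

lemma pairing_nondegenerate:
  assumes near: "cmod (\<mu> - l) < \<bar>Im l\<bar>"
    and \<zeta>: "\<zeta> \<in> l2_init \<mu>"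
    and orth: "\<And>\<xi>. \<xi> \<in> l2_init l \<Longrightarrow> pairing (sol l \<xi>) (sol \<mu> \<zeta>) = 0"
  shows "\<zeta> \<in> null_init"
proof -
  define z where "z = sol \<mu> \<zeta>"
  define Z where "Z = (\<Sum>k. Re (herm_form (\<Psi> k) (z k)))"
  define r where "r = cmod (\<mu> - l) / \<bar>Im l\<bar>"
  define q where "q N = Re (form {..<N} z z)" for N
  have zl2: "z \<in> l2_psi \<Psi>" using \<zeta> by (simp add: l2_init_def z_def)
  have Iml: "Im l \<noteq> 0" "\<bar>Im l\<bar> > 0" using near norm_ge_zero[of "\<mu> - l"] by linarith+
  have r: "0 \<le> r" "r < 1" using near Iml by (auto simp: r_def)
  have qZ: "q N \<le> Z" for N unfolding q_def Z_def using l2_form_le[OF zl2] by simp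
  have q_lim: "q \<longlonglongrightarrow> Z"
    using summable_LIMSEQ[of "\<lambda>k. Re (herm_form (\<Psi> k) (z k))"] zl2
    by (simp add: q_def[abs_def] Z_def Re_form_self l2_iff_summable)
  have Z0: "0 \<le> Z" using qZ[of 0] by (simp add: q_def form_def)
  \<comment> \<open>The first two conditions will bound the initial values; the third is the lower
    bound to be passed to the limit.\<close>
  have "\<exists>\<omega>. (\<forall>\<kappa>\<in>null_init. orthogonal \<omega> \<kappa>) \<and> Re (form {..<N} (sol l \<omega>) (sol l \<omega>)) \<le> Z
      \<and> q N - r\<^sup>2 * Z \<le> Re (form {..<N} (sol l \<omega>) z)" for N
  proof -
    let ?F = "form {..<N}"
    obtain \<xi> where \<xi>: "\<And>\<eta>. ?F (sol l \<eta>) (\<lambda>k. z k - sol l \<xi> k) = 0"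
      using projection_exists[of "sol l", OF sol_add sol_scale] by metis
    obtain \<omega> where \<omega>: "\<And>\<kappa>. \<kappa> \<in> null_init \<Longrightarrow> orthogonal \<omega> \<kappa>"
      "\<And>k. \<Psi> k *v sol l \<omega> k = \<Psi> k *v sol l \<xi> k"
      using orthogonal_representative by metis
    let ?p = "sol l \<omega>"
    define f where "f = (\<lambda>k. z k - ?p k)"
    have pf: "?F (sol l \<eta>) f = 0" for \<eta>
      using \<xi>[of \<eta>] \<omega>(2) by (simp add: f_def form_def matrix_vector_mult_diff_distrib)
    then have fp: "?F f (sol l \<eta>) = 0" for \<eta>
      by (subst form_commute) simp
    \<comment> \<open>On the window, \<open>z\<close> is the sum of the orthogonal parts
      \<open>?p\<close> and \<open>f\<close>; \<open>zz\<close> is the theorem of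
      Pythagoras.\<close>
    have pz: "?F ?p z = ?F ?p ?p" using pf[of \<omega>] by (simp add: f_def form_diff)
    have fz: "?F f z = ?F f f" using fp[of \<omega>] unfolding f_def form_diff(2)[of _ _ z] by simp
    have "?F z z = ?F ?p z + ?F f z" using form_diff(1)[of "{..<N}" z ?p z] by (simp add: f_def)
    then have zz: "?F z z = ?F ?p ?p + ?F f f" by (simp only: pz fz)
    have f0: "0 \<le> Re (?F f f)" and p0: "0 \<le> Re (?F ?p ?p)" by (rule form_self_nonneg)+
    have "\<bar>Im l\<bar> * cmod (?F f z) \<le> cmod (\<mu> - l) * (sqrt (Re (?F f f)) * sqrt (q N))"
      unfolding z_def q_def by (rule orthogonal_defect_bound[OF Iml(1) fp])
    then have "cmod (?F f z) \<le> r * (sqrt (Re (?F f f)) * sqrt (q N))"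
      using Iml by (simp add: r_def field_simps)
    moreover have "cmod (?F f z) = sqrt (Re (?F f f)) * sqrt (Re (?F f f))"
      unfolding fz using f0 by (subst form_self_real) simp
    ultimately have *: "sqrt (Re (?F f f)) * sqrt (Re (?F f f)) \<le> sqrt (Re (?F f f)) * (r * sqrt (q N))"
      by (simp only: ac_simps)
    have qN: "0 \<le> q N" by (simp add: q_def form_self_nonneg)
    have "sqrt (Re (?F f f)) \<le> r * sqrt (q N)"
    proof (cases "Re (?F f f) = 0")
      case True
      then show ?thesis using r qN by simp
    next
      case False
      then have "0 < sqrt (Re (?F f f))" using f0 by simp
      then show ?thesis using * by (simp only: mult_le_cancel_left_pos)
    qed
    then have "(sqrt (Re (?F f f)))\<^sup>2 \<le> (r * sqrt (q N))\<^sup>2"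
      using f0 by (intro power_mono) auto
    then have "Re (?F f f) \<le> r\<^sup>2 * q N" using f0 qN by (simp add: power_mult_distrib)
    also have "\<dots> \<le> r\<^sup>2 * Z" using qZ by (simp add: mult_left_mono)
    finally have "Re (?F f f) \<le> r\<^sup>2 * Z" .
    moreover have "q N = Re (?F ?p ?p) + Re (?F f f)" by (simp add: q_def zz)
    ultimately show ?thesis using \<omega>(1) qZ[of N] f0 by (intro exI[of _ \<omega>]) (auto simp: pz)
  qed
  then obtain \<omega> where \<omega>: "\<And>N \<kappa>. \<kappa> \<in> null_init \<Longrightarrow> orthogonal (\<omega> N) \<kappa>"
    "\<And>N. Re (form {..<N} (sol l (\<omega> N)) (sol l (\<omega> N))) \<le> Z"
    "\<And>N. q N - r\<^sup>2 * Z \<le> Re (form {..<N} (sol l (\<omega> N)) z)"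
    by metis
  have p_le: "Re (form A (sol l (\<omega> N)) (sol l (\<omega> N))) \<le> Z" if "A \<subseteq> {..<N}" for A N
    using form_self_mono[OF that, of "sol l (\<omega> N)"] \<omega>(2)[of N] by simp
  obtain m c where mc: "c > 0"
    "\<And>\<xi>. (\<forall>\<kappa>\<in>null_init. orthogonal \<xi> \<kappa>) \<Longrightarrow> c * (norm \<xi>)\<^sup>2 \<le> Re (form {..<m} (sol l \<xi>) (sol l \<xi>))"
    using form_sol_coercive by metis
  \<comment> \<open>The shift by \<open>m\<close> ensures that the window of the projection contains
    the window of coercivity.\<close>
  have "norm (\<omega> (n + m)) \<le> sqrt (Z / c)" for n
  proof (rule real_le_rsqrt)
    have "c * (norm (\<omega> (n + m)))\<^sup>2 \<le> Z"
      using mc(2)[of "\<omega> (n + m)"] \<omega>(1) p_le[of "{..<m}" "n + m"] by force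
    then show "(norm (\<omega> (n + m)))\<^sup>2 \<le> Z / c" using mc(1) by (simp add: field_simps)
  qed
  then have "bounded (range (\<lambda>n. \<omega> (n + m)))"
    by (auto simp: bounded_iff)
  then obtain \<omega>0 \<rho> where "strict_mono \<rho>" and lim': "((\<lambda>n. \<omega> (n + m)) \<circ> \<rho>) \<longlonglongrightarrow> \<omega>0"
    using bounded_imp_convergent_subsequence by blast
  define \<sigma> where "\<sigma> n = \<rho> n + m" for n
  have \<sigma>: "n \<le> \<sigma> n" for n using seq_suble[OF \<open>strict_mono \<rho>\<close>, of n] by (simp add: \<sigma>_def)
  have lim: "(\<lambda>n. \<omega> (\<sigma> n)) \<longlonglongrightarrow> \<omega>0" using lim' by (simp add: o_def \<sigma>_def)
  have form_lim: "(\<lambda>n. Re (form A (sol l (\<omega> (\<sigma> n))) (sol l (\<omega> (\<sigma> n))))) \<longlonglongrightarrow> Re (form A (sol l \<omega>0) (sol l \<omega>0))"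
    "(\<lambda>n. Re (form A (sol l (\<omega> (\<sigma> n))) z)) \<longlonglongrightarrow> Re (form A (sol l \<omega>0) z)" for A
    by (intro tendsto_Re continuous_on_tendsto_compose[OF _ lim, of UNIV] continuous_intros; simp)+
  have "\<omega>0 \<in> l2_init l"
    unfolding l2_init_def mem_Collect_eq
  proof (rule l2_boundedI)
    fix M
    have "Re (form {..<M} (sol l (\<omega> (\<sigma> n))) (sol l (\<omega> (\<sigma> n)))) \<le> Z" if "n \<ge> M" for n
      using that \<sigma>[of n] by (intro p_le) auto
    then show "Re (form {..<M} (sol l \<omega>0) (sol l \<omega>0)) \<le> Z"
      using LIMSEQ_le_const2[OF form_lim(1)] by blast
  qed
  then have "(\<lambda>M. form {..<M} (sol l \<omega>0) z) \<longlonglongrightarrow> 0"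
    using pairing_LIMSEQ[of "sol l \<omega>0" z] orth[of \<omega>0] zl2 by (simp add: l2_init_def z_def)
  then have pair_lim: "(\<lambda>M. Re (form {..<M} (sol l \<omega>0) z)) \<longlonglongrightarrow> 0"
    using tendsto_Re by fastforce
  \<comment> \<open>The lower bound holds on the window \<open>{..<\<sigma> n}\<close>, whereas the
    limit needs a fixed \<open>M\<close>. Cauchy--Schwarz bounds the loss on
    \<open>{M..<\<sigma> n}\<close> by a quantity that tends to 0 as \<open>M\<close> grows.\<close>
  have tail: "q M - r\<^sup>2 * Z - sqrt Z * sqrt (Z - q M) \<le> Re (form {..<M} (sol l \<omega>0) z)" for M
  proof (rule LIMSEQ_le_const[OF form_lim(2)], intro exI allI impI)
    fix n assume "M \<le> n"
    then have M: "M \<le> \<sigma> n" using \<sigma>[of n] by simp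
    let ?p = "sol l (\<omega> (\<sigma> n))" and ?A = "{M..<\<sigma> n}"
    have split: "form {..<\<sigma> n} x y = form {..<M} x y + form ?A x y" for x y
      using form_union[of "{..<M}" ?A x y] M by (simp add: ivl_disj_un disjoint_iff)
    have "cmod (form ?A ?p z) \<le> sqrt (Re (form ?A ?p ?p)) * sqrt (Re (form ?A z z))"
      by (rule form_le)
    also have "\<dots> \<le> sqrt Z * sqrt (Z - q M)"
    proof (intro mult_mono real_sqrt_le_mono)
      show "Re (form ?A ?p ?p) \<le> Z" by (rule p_le) auto
      show "Re (form ?A z z) \<le> Z - q M" using split[of z z] qZ[of "\<sigma> n"] by (simp add: q_def)
    qed (use Z0 form_self_nonneg[of ?A z] in auto)
    finally have "Re (form ?A ?p z) \<le> sqrt Z * sqrt (Z - q M)"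
      using complex_Re_le_cmod order_trans by blast
    moreover have "q M \<le> q (\<sigma> n)" unfolding q_def using M by (intro form_self_mono) auto
    ultimately show "q M - r\<^sup>2 * Z - sqrt Z * sqrt (Z - q M) \<le> Re (form {..<M} ?p z)"
      using \<omega>(3)[of "\<sigma> n"] split[of ?p z] by simp
  qed
  have "(\<lambda>M. q M - r\<^sup>2 * Z - sqrt Z * sqrt (Z - q M)) \<longlonglongrightarrow> Z - r\<^sup>2 * Z - sqrt Z * sqrt (Z - Z)"
    by (intro tendsto_intros q_lim)
  then have "Z - r\<^sup>2 * Z - sqrt Z * sqrt (Z - Z) \<le> 0"
    using pair_lim tail by (intro LIMSEQ_le[of _ _ "\<lambda>M. Re (form {..<M} (sol l \<omega>0) z)"]) auto
  then have "Z * (1 - r\<^sup>2) \<le> 0" by (simp add: algebra_simps)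
  moreover have "r\<^sup>2 < 1" using r by (simp add: power_less_one_iff)
  ultimately have "Z \<le> 0" by (simp add: mult_le_0_iff)
  then have "Re (herm_form (\<Psi> k) (z k)) = 0" for k
    using l2_form_le[OF zl2, of "{k}"] herm_form_nonneg[of k "z k"] by (simp add: Z_def Re_form_self)
  then show ?thesis by (simp add: null_init_iff[of _ \<mu>] weight_mult_eq_0_iff z_def)
qed

text \<open>Pairing with a complement of \<open>null_init\<close> in \<open>l2_init l\<close> gives
  functionals on \<open>l2_init \<mu>\<close> whose common kernel lies in \<open>null_init\<close>.
  The dimension of \<open>null_init\<close> left out of the complement comes back as the kernel
  bound.\<close>

lemma dim_l2_init_le:
  assumes near: "cmod (\<mu> - l) < \<bar>Im l\<bar>"
  shows "vec.dim (l2_init \<mu>) \<le> vec.dim (l2_init l)"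
proof -
  obtain A where A: "A \<subseteq> null_init" "vec.independent A" "null_init \<subseteq> vec.span A" "card A = vec.dim null_init"
    using vec.basis_exists[of null_init] by blast
  then have "A \<subseteq> l2_init l" using null_init_subset by blast
  then obtain B where B: "A \<subseteq> B" "B \<subseteq> l2_init l" "vec.independent B" "l2_init l \<subseteq> vec.span B"
    using vec.maximal_independent_subset_extend[of A "l2_init l"] A by metis
  have finB: "finite B" using B(3) vec.finiteI_independent by blast
  have cardB: "card B = vec.dim (l2_init l)"
    using B by (intro vec.basis_card_eq_dim) auto
  define b where "b c \<zeta> = pairing (sol l c) (sol \<mu> \<zeta>)" for c \<zeta>
  have l2: "sol l \<xi> \<in> l2_psi \<Psi>" if "\<xi> \<in> l2_init l" for l \<xi> using that by (simp add: l2_init_def)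
  have "vec.dim (l2_init \<mu>) \<le> vec.dim {\<zeta> \<in> l2_init \<mu>. \<forall>c\<in>B - A. b c \<zeta> = 0} + card (B - A)"
  proof (rule dim_le_dim_kernel_plus_card[THEN conjunct1, OF _ subspace_l2_init])
    fix c x y assume "c \<in> B - A" "x \<in> l2_init \<mu>" "y \<in> l2_init \<mu>"
    then show "b c (x + y) = b c x + b c y"
      using B l2 pairing_add(2)[of "sol \<mu> x" "sol \<mu> y" "sol l c"]
      by (auto simp: b_def sol_add[abs_def])
  next
    fix c r x assume "c \<in> B - A" "x \<in> l2_init \<mu>"
    then show "b c (r *s x) = r * b c x"
      using B l2 pairing_scale(2)[of "sol l c" "sol \<mu> x" r]
      by (auto simp: b_def sol_scale[abs_def])
  qed (use finB in auto)
  also have "vec.dim {\<zeta> \<in> l2_init \<mu>. \<forall>c\<in>B - A. b c \<zeta> = 0} \<le> vec.dim null_init"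
  proof (rule vec.dim_subset, safe)
    fix \<zeta> assume \<zeta>: "\<zeta> \<in> l2_init \<mu>" "\<forall>c\<in>B - A. b c \<zeta> = 0"
    have b_null: "b \<kappa> \<zeta> = 0" if "\<kappa> \<in> null_init" for \<kappa>
      using that by (simp add: b_def pairing_def null_init_iff[of _ l] cip_weight_swap[symmetric])
    have "B \<subseteq> {\<xi> \<in> l2_init l. b \<xi> \<zeta> = 0}"
      using \<zeta>(2) b_null A(1) B(2) by blast
    \<comment> \<open>Vanishing on \<open>B\<close> thus extends to its span, hence to all of
      \<open>l2_init l\<close>.\<close>
    moreover have "vec.subspace {\<xi> \<in> l2_init l. b \<xi> \<zeta> = 0}"
    proof (rule vec.subspaceI)
      show "0 \<in> {\<xi> \<in> l2_init l. b \<xi> \<zeta> = 0}"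
        using b_null vec.subspace_0[OF subspace_l2_init] vec.subspace_0[OF subspace_null_init] by simp
    next
      fix x y assume "x \<in> {\<xi> \<in> l2_init l. b \<xi> \<zeta> = 0}" "y \<in> {\<xi> \<in> l2_init l. b \<xi> \<zeta> = 0}"
      then show "x + y \<in> {\<xi> \<in> l2_init l. b \<xi> \<zeta> = 0}"
        using pairing_add(1)[OF l2 l2 l2[OF \<zeta>(1)], of x l y l] vec.subspace_add[OF subspace_l2_init, of x l y]
        by (simp add: b_def sol_add[abs_def])
    next
      fix c x assume "x \<in> {\<xi> \<in> l2_init l. b \<xi> \<zeta> = 0}"
      then show "c *s x \<in> {\<xi> \<in> l2_init l. b \<xi> \<zeta> = 0}"
        using pairing_scale(1)[OF l2 l2[OF \<zeta>(1)], of x l c] vec.subspace_scale[OF subspace_l2_init, of x l c]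
        by (simp add: b_def sol_scale[abs_def])
    qed
    ultimately have "l2_init l \<subseteq> {\<xi> \<in> l2_init l. b \<xi> \<zeta> = 0}"
      using B(4) vec.span_minimal[of B "{\<xi> \<in> l2_init l. b \<xi> \<zeta> = 0}"] by blast
    then show "\<zeta> \<in> null_init"
      using pairing_nondegenerate[OF near \<zeta>(1)] by (auto simp: b_def)
  qed
  also have "vec.dim null_init + card (B - A) = card B"
    using A(4) B(1) finB card_mono[OF finB B(1)] finite_subset[OF B(1) finB]
    by (simp add: card_Diff_subset)
  finally show ?thesis using cardB by simp
qed

lemma dim_l2_init_constant_on:
  assumes U: "connected U" "\<And>l. l \<in> U \<Longrightarrow> Im l \<noteq> 0"
  shows "(\<lambda>l. vec.dim (l2_init l)) constant_on U"
proof -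
  have loc: "\<forall>\<^sub>F m in at l within U. vec.dim (l2_init l) = vec.dim (l2_init m)" if "l \<in> U" for l
    unfolding eventually_at
  \<comment> \<open>Half the radius makes nearness symmetric: \<open>\<bar>Im m\<bar>\<close> still
    exceeds \<open>\<bar>Im l\<bar> / 2\<close>, so the inequality of dimensions applies both
    ways.\<close>
  proof (intro exI[of _ "\<bar>Im l\<bar> / 2"] conjI ballI impI)
    show "0 < \<bar>Im l\<bar> / 2" using U(2)[OF that] by simp
    fix m assume m: "m \<noteq> l \<and> dist m l < \<bar>Im l\<bar> / 2"
    have "\<bar>Im m - Im l\<bar> \<le> cmod (m - l)" using abs_Im_le_cmod[of "m - l"] by simp
    then have "cmod (m - l) < \<bar>Im l\<bar>" "cmod (l - m) < \<bar>Im m\<bar>"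
      using m by (auto simp: dist_norm norm_minus_commute)
    then show "vec.dim (l2_init l) = vec.dim (l2_init m)"
      by (intro antisym dim_l2_init_le)
  qed
  have "vec.dim (l2_init a) = vec.dim (l2_init b)" if "a \<in> U" "b \<in> U" for a b
    using connected_local_const[OF U(1) that, of "\<lambda>l. vec.dim (l2_init l)"] loc by blast
  then show ?thesis unfolding constant_on_def by metis
qed

section \<open>The two indices as dimensions of spaces of initial values\<close>

lemma M_space_eq: "M_space S \<Psi> l = sol l ` l2_init l"
proof -
  have "z = sol l (z 0) \<Longrightarrow> z \<in> l2_psi \<Psi> \<Longrightarrow> z \<in> sol l ` l2_init l" for z
    by (metis (mono_tags, lifting) imageI l2_init_def mem_Collect_eq)
  then show ?thesis
    by (auto simp: M_space_def L_op_eq_iff_sol l2_init_def)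
qed

lemma d_sol_eq: "d_sol S \<Psi> l = vec.dim (l2_init l)"
proof -
  let ?W = "seq_space\<lparr>carrier := M_space S \<Psi> l\<rparr>"
  interpret linear_image "l2_init l" ?W "sol l"
    by (rule linear_image.intro)
      (auto simp: subspace_l2_init M_space_eq seq_space_def fun_eq_iff sol_add sol_scale)
  \<comment> \<open>Evaluation at index 0 recovers the initial value.\<close>
  have "{x \<in> l2_init l. sol l x = \<zero>\<^bsub>?W\<^esub>} \<subseteq> {0}"
    by (auto simp: seq_space_def fun_eq_iff dest: spec[of _ 0])
  then have "vec.dim {x \<in> l2_init l. sol l x = \<zero>\<^bsub>?W\<^esub>} = 0"
    by (simp add: vec.dim_eq_0)
  then show ?thesis using dim_linear_image unfolding d_sol_def by linarith
qed

text \<open>For \<open>u\<close> and \<open>f\<close> from \<open>T_max\<close>, the weight sends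
  \<open>f\<close> and \<open>l *s u\<close> to the same sequence, so \<open>u\<close> is a genuine
  solution in the given class.\<close>

lemma M_quot_eq: "M_quot S \<Psi> l = (\<lambda>\<xi>. psi_class \<Psi> (sol l \<xi>)) ` l2_init l"
proof (intro subset_antisym subsetI)
  fix Z assume "Z \<in> M_quot S \<Psi> l"
  then have "(Z, l \<odot>\<^bsub>l2_quot \<Psi>\<^esub> Z) \<in> T_max S \<Psi>" by (simp add: M_quot_def)
  then obtain z f u where z: "Z = psi_class \<Psi> z" "l \<odot>\<^bsub>l2_quot \<Psi>\<^esub> Z = psi_class \<Psi> f"
    "z \<in> l2_psi \<Psi>" "f \<in> l2_psi \<Psi>" "u \<in> psi_class \<Psi> z" "\<And>k. L_op S u k = \<Psi> k *v f k"
    by (auto simp: T_max_def)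
  have u: "u \<in> l2_psi \<Psi>" "\<And>k. \<Psi> k *v z k = \<Psi> k *v u k"
    using z(5) by (auto simp: mem_psi_class_iff)
  have "psi_class \<Psi> (\<lambda>k. l *s z k) = psi_class \<Psi> f"
    using z smult_l2_quot[of z l] by simp
  then have "\<Psi> k *v f k = l *s (\<Psi> k *v u k)" for k
    using psi_class_eq_iff[OF l2_scale[OF z(3)] z(4)] u(2) by (simp add: vec.scale)
  then have "u = sol l (u 0)" using z(6) by (simp add: L_op_eq_iff_sol[symmetric])
  then have "u 0 \<in> l2_init l" "psi_class \<Psi> (sol l (u 0)) = Z"
    using u z psi_class_eq_iff[OF z(3) u(1)] by (simp_all add: l2_init_def)
  then show "Z \<in> (\<lambda>\<xi>. psi_class \<Psi> (sol l \<xi>)) ` l2_init l" by blast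
next
  fix Z assume "Z \<in> (\<lambda>\<xi>. psi_class \<Psi> (sol l \<xi>)) ` l2_init l"
  then obtain \<xi> where \<xi>: "sol l \<xi> \<in> l2_psi \<Psi>" "Z = psi_class \<Psi> (sol l \<xi>)"
    by (auto simp: l2_init_def)
  have "\<forall>k. L_op S (sol l \<xi>) k = l *s (\<Psi> k *v sol l \<xi> k)"
    by (simp add: L_op_eq_iff_sol)
  then have L: "\<forall>k. L_op S (sol l \<xi>) k = \<Psi> k *v (l *s sol l \<xi> k)"
    by (simp add: vec.scale)
  have "sol l \<xi> \<in> psi_class \<Psi> (sol l \<xi>)" using \<xi>(1) by (simp add: mem_psi_class_iff)
  then have "(psi_class \<Psi> (sol l \<xi>), psi_class \<Psi> (\<lambda>k. l *s sol l \<xi> k)) \<in> T_max S \<Psi>"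
    unfolding T_max_def using \<xi>(1) l2_scale[OF \<xi>(1)] L by blast
  then show "Z \<in> M_quot S \<Psi> l"
    using \<xi> by (simp add: M_quot_def carrier_l2_quot smult_l2_quot)
qed

text \<open>A solution has the zero class exactly if its initial value is in
  \<open>null_init\<close>, so this is rank-nullity for the quotient map.\<close>

lemma d_quot_eq: "d_quot S \<Psi> l + vec.dim null_init = d_sol S \<Psi> l"
proof -
  let ?W = "(l2_quot \<Psi>)\<lparr>carrier := M_quot S \<Psi> l\<rparr>" and ?T = "\<lambda>\<xi>. psi_class \<Psi> (sol l \<xi>)"
  have zero: "\<zero>\<^bsub>?W\<^esub> = ?T 0" by (simp add: l2_quot_def sol_zero[abs_def])
  interpret linear_image "l2_init l" ?W ?T
  proof (rule linear_image.intro)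
    show "?T x \<oplus>\<^bsub>?W\<^esub> ?T y = ?T (x + y)" if "x \<in> l2_init l" "y \<in> l2_init l" for x y
      using that add_l2_quot[of "sol l x" "sol l y"] by (simp add: l2_init_def sol_add[abs_def])
    show "c \<odot>\<^bsub>?W\<^esub> ?T x = ?T (c *s x)" if "x \<in> l2_init l" for c x
      using that smult_l2_quot[of "sol l x" c] by (simp add: l2_init_def sol_scale[abs_def])
  qed (use zero in \<open>simp_all add: subspace_l2_init M_quot_eq\<close>)
  have "?T x = ?T 0 \<longleftrightarrow> x \<in> null_init" if "x \<in> l2_init l" for x
    using that vec.subspace_0[OF subspace_l2_init, of l]
    by (subst psi_class_eq_iff) (simp_all add: l2_init_def null_init_iff[of _ l])
  then have "{x \<in> l2_init l. ?T x = \<zero>\<^bsub>?W\<^esub>} = null_init"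
    unfolding zero using null_init_subset by blast
  then show ?thesis using dim_linear_image by (simp add: d_quot_def d_sol_eq)
qed

text \<open>Definiteness quantifies over all parameters, but solutions of norm zero have the same
  initial values for each of them; testing the parameter 0 suffices.\<close>

lemma definite_system_iff: "definite_system S \<Psi> \<longleftrightarrow> vec.dim null_init = 0"
proof -
  have "definite_system S \<Psi> \<longleftrightarrow> null_init \<subseteq> {0}"
  proof
    assume *: "definite_system S \<Psi>"
    have "sol 0 \<xi> = (\<lambda>k. 0)" if "\<xi> \<in> null_init" for \<xi>
    proof -
      have "is_solution S \<Psi> 0 (sol 0 \<xi>)" by (simp add: is_solution_iff)
      moreover have "psi_norm_sq \<Psi> (sol 0 \<xi>) = 0"
        using that by (simp add: psi_norm_sq_eq_0_iff null_init_def)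
      ultimately show ?thesis using * unfolding definite_system_def by fastforce
    qed
    then show "null_init \<subseteq> {0}" by (metis sol.simps(1) singletonI subsetI)
  next
    assume *: "null_init \<subseteq> {0}"
    have "z = (\<lambda>k. 0)" if "z = sol l (z 0)" "psi_norm_sq \<Psi> z = 0" for l z
    proof -
      have "z 0 \<in> null_init"
        using that psi_norm_sq_eq_0_iff[of z] by (simp add: null_init_iff[of _ l])
      then have "z 0 = 0" using * by blast
      then show ?thesis using that(1) by (simp add: fun_eq_iff)
    qed
    then show "definite_system S \<Psi>"
      unfolding definite_system_def is_solution_iff by (auto simp: zero_less_iff_neq_zero)
  qed
  then show ?thesis by (simp add: vec.dim_eq_0)
qed

end

theorem corollary5p12:
  fixes S \<Psi> :: "nat \<Rightarrow> ('n::finite) cmat" and l :: complex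
  assumes "\<And>k. conj_transpose (S k) ** J_mat ** S k = J_mat"
    and "\<And>k. pos_semidef (\<Psi> k)"
    and "\<And>k. \<Psi> k ** J_mat ** \<Psi> k = 0"
  shows "(d_quot S \<Psi> l = d_sol S \<Psi> l \<longleftrightarrow> definite_system S \<Psi>)
    \<and> ((\<forall>\<mu>. 0 \<le> int (d_sol S \<Psi> \<mu>) - int (d_quot S \<Psi> \<mu>))
        \<and> (\<lambda>\<mu>. int (d_sol S \<Psi> \<mu>) - int (d_quot S \<Psi> \<mu>)) constant_on UNIV)
    \<and> (d_sol S \<Psi> constant_on {\<mu>. Im \<mu> > 0} \<and> d_sol S \<Psi> constant_on {\<mu>. Im \<mu> < 0})"
proof -
  interpret symplectic_system \<Psi> S
    using assms by unfold_locales
  \<comment> \<open>The right-hand side is free of \<open>\<mu>\<close>, which gives nonnegativity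
    and constancy at once.\<close>
  have diff: "int (d_sol S \<Psi> \<mu>) - int (d_quot S \<Psi> \<mu>) = int (vec.dim null_init)" for \<mu>
    using d_quot_eq[of \<mu>] by linarith
  have "d_sol S \<Psi> = (\<lambda>l. vec.dim (l2_init l))" by (simp add: fun_eq_iff d_sol_eq)
  moreover have "connected {\<mu>. Im \<mu> > 0}" "connected {\<mu>. Im \<mu> < 0}"
    by (intro convex_connected convex_halfspace_Im_gt convex_halfspace_Im_lt)+
  ultimately have "d_sol S \<Psi> constant_on {\<mu>. Im \<mu> > 0}" "d_sol S \<Psi> constant_on {\<mu>. Im \<mu> < 0}"
    by (auto intro: dim_l2_init_constant_on)
  moreover have "d_quot S \<Psi> l = d_sol S \<Psi> l \<longleftrightarrow> definite_system S \<Psi>"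
    using d_quot_eq[of l] definite_system_iff by linarith
  ultimately show ?thesis by (auto simp: diff constant_on_def)
qed

end
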